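(* Let $\vartheta$ be a primitive and geometrically compatible random substitution on a finite alphabet $\mathcal A$, with geometric hull $(Y_\vartheta,T)$. Then for every $a\in\mathcal A$ the limit \[ h_a^G=\lim_{m\to\infty}\frac{1}{L(\vartheta^m(a))}\log\big(\#\vartheta^m(a)\big) \] exists and $h_a^G=h_{\mathrm{top}}(Y_\vartheta)$.
   Context: $\mathcal A$ is a finite alphabet, $\mathcal A^+$ the set of non-empty finite words over $\mathcal A$; for $w\in\mathcal A^+$, $|w|$ is its length and $|w|_a$ the number of occurrences of the letter $a$ in $w$. $\mathcal A^{\mathbb Z}$ carries the product topology and the left shift $S$. A random substitution is a map $\vartheta$ from $\mathcal A$ to the non-empty finite subsets of $\mathcal A^+$, extended to words by $\vartheta(u_1\cdots u_n)=\{w_1\cdots w_n: w_i\in\vartheta(u_i)\}$ and to sets of words by taking unions; $\vartheta^n$ is the $n$-fold composition. The language $\mathcal L_\vartheta$ is the set of all subwords of words in $\bigcup_{n\ge1,a\in\mathcal A}\vartheta^n(a)$, and $X_\vartheta=\{x\in\mathcal A^{\mathbb Z}: x_i\cdots x_j\in\mathcal L_\vartheta\text{ for all }i\le j\}$. A marginal of $\vartheta$ is a map $\theta:\mathcal A\to\mathcal A^+$ with $\theta(a)\in\vartheta(a)$ for all $a$; its substitution matrix is $M_{ab}=|\theta(b)|_a$. $\vartheta$ is primitive if for some $n\in\mathbb N$ some marginal of $\vartheta^n$ has a primitive substitution matrix. $\vartheta$ is geometrically compatible if there are $\lambda>1$ and a row vector $L\in(0,\infty)^{\mathcal A}$ that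 is a left eigenvector with eigenvalue $\lambda$ of the substitution matrix of every marginal of $\vartheta$; fix such $L$ and write $L(w)=\sum_{a}L_a|w|_a$ (all words in $\vartheta^m(a)$ have the same geometric length, denoted $L(\vartheta^m(a))=\lambda^mL_a$). The geometric hull $(Y_\vartheta,T)$ is the suspension flow over $(X_\vartheta,S)$ with roof function $x\mapsto L_{x_0}$: $Y_\vartheta=\{(x,s):x\in X_\vartheta,\,0\le s\le L_{x_0}\}$ with $(x,L_{x_0})$ identified with $(Sx,0)$, and $T_t(x,s)=(x,s+t)$. *)

theory Defs
  imports "HOL-Analysis.Analysis"
begin

type_synonym 'a rsubst = "'a \<Rightarrow> 'a list set"

definition random_subst :: "'a rsubst \<Rightarrow> bool" where
  "random_subst \<Theta> \<longleftrightarrow> (\<forall>a. finite (\<Theta> a) \<and> \<Theta> a \<noteq> {} \<and> [] \<notin> \<Theta> a)"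

definition subst_word :: "'a rsubst \<Rightarrow> 'a list \<Rightarrow> 'a list set" where
  "subst_word \<Theta> u = {concat ws | ws. list_all2 (\<lambda>w a. w \<in> \<Theta> a) ws u}"

fun subst_pow :: "'a rsubst \<Rightarrow> nat \<Rightarrow> 'a rsubst" where
  "subst_pow \<Theta> 0 a = {[a]}"
| "subst_pow \<Theta> (Suc n) a = (\<Union>u \<in> subst_pow \<Theta> n a. subst_word \<Theta> u)"

definition language :: "'a rsubst \<Rightarrow> 'a list set" where
  "language \<Theta> = {w. w \<noteq> [] \<and> (\<exists>n\<ge>1. \<exists>a. \<exists>v \<in> subst_pow \<Theta> n a. \<exists>u1 u2. v = u1 @ w @ u2)}"

definition subshift :: "'a rsubst \<Rightarrow> (int \<Rightarrow> 'a) set" where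
  "subshift \<Theta> = {x. \<forall>i j. i \<le> j \<longrightarrow> map x [i..j] \<in> language \<Theta>}"

definition shift :: "(int \<Rightarrow> 'a) \<Rightarrow> (int \<Rightarrow> 'a)" where
  "shift x = (\<lambda>i. x (i + 1))"

definition marginal_of :: "'a rsubst \<Rightarrow> ('a \<Rightarrow> 'a list) \<Rightarrow> bool" where
  "marginal_of \<Theta> \<theta> \<longleftrightarrow> (\<forall>a. \<theta> a \<in> \<Theta> a)"

definition subst_matrix :: "('a \<Rightarrow> 'a list) \<Rightarrow> 'a \<Rightarrow> 'a \<Rightarrow> nat" where
  "subst_matrix \<theta> a b = count_list (\<theta> b) a"

fun mat_pow :: "('a::finite \<Rightarrow> 'a \<Rightarrow> nat) \<Rightarrow> nat \<Rightarrow> 'a \<Rightarrow> 'a \<Rightarrow> nat" where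
  "mat_pow M 0 = (\<lambda>a b. if a = b then 1 else 0)"
| "mat_pow M (Suc k) = (\<lambda>a b. \<Sum>c\<in>UNIV. M a c * mat_pow M k c b)"

definition primitive_matrix :: "('a::finite \<Rightarrow> 'a \<Rightarrow> nat) \<Rightarrow> bool" where
  "primitive_matrix M \<longleftrightarrow> (\<exists>k\<ge>1. \<forall>a b. mat_pow M k a b > 0)"

definition primitive_rsubst :: "('a::finite) rsubst \<Rightarrow> bool" where
  "primitive_rsubst \<Theta> \<longleftrightarrow>
     (\<exists>n\<ge>1. \<exists>\<theta>. marginal_of (subst_pow \<Theta> n) \<theta> \<and> primitive_matrix (subst_matrix \<theta>))"

definition geom_compatible_data :: "('a::finite) rsubst \<Rightarrow> real \<Rightarrow> ('a \<Rightarrow> real) \<Rightarrow> bool" where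
  "geom_compatible_data \<Theta> lam L \<longleftrightarrow> lam > 1 \<and> (\<forall>a. L a > 0) \<and>
     (\<forall>\<theta>. marginal_of \<Theta> \<theta> \<longrightarrow>
        (\<forall>b. (\<Sum>a\<in>UNIV. L a * real (subst_matrix \<theta> a b)) = lam * L b))"

definition X_top :: "'a rsubst \<Rightarrow> (int \<Rightarrow> 'a) topology" where
  "X_top \<Theta> = subtopology (product_topology (\<lambda>_. discrete_topology UNIV) UNIV) (subshift \<Theta>)"

definition susp_domain :: "'a rsubst \<Rightarrow> ('a \<Rightarrow> real) \<Rightarrow> ((int \<Rightarrow> 'a) \<times> real) set" where
  "susp_domain \<Theta> L = {(x, s). x \<in> subshift \<Theta> \<and> 0 \<le> s \<and> s \<le> L (x 0)}"

definition susp_domain_top :: "'a rsubst \<Rightarrow> ('a \<Rightarrow> real) \<Rightarrow> ((int \<Rightarrow> 'a) \<times> real) topology" where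
  "susp_domain_top \<Theta> L = subtopology (prod_topology (X_top \<Theta>) euclideanreal) (susp_domain \<Theta> L)"

text \<open>Canonical representatives of the points of Y_theta: (x,s) with 0 <= s < L_{x_0};
  the identification (x, L_{x_0}) = (Sx, 0) is implemented by the map susp_quot.\<close>
definition susp_reps :: "'a rsubst \<Rightarrow> ('a \<Rightarrow> real) \<Rightarrow> ((int \<Rightarrow> 'a) \<times> real) set" where
  "susp_reps \<Theta> L = {(x, s). x \<in> subshift \<Theta> \<and> 0 \<le> s \<and> s < L (x 0)}"

definition susp_quot :: "('a \<Rightarrow> real) \<Rightarrow> (int \<Rightarrow> 'a) \<times> real \<Rightarrow> (int \<Rightarrow> 'a) \<times> real" where
  "susp_quot L p = (if snd p = L (fst p 0) then (shift (fst p), 0) else p)"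

definition Y_top :: "'a rsubst \<Rightarrow> ('a \<Rightarrow> real) \<Rightarrow> ((int \<Rightarrow> 'a) \<times> real) topology" where
  "Y_top \<Theta> L = topology (\<lambda>U. U \<subseteq> susp_reps \<Theta> L \<and>
      openin (susp_domain_top \<Theta> L) {p \<in> susp_domain \<Theta> L. susp_quot L p \<in> U})"

definition roof_sum :: "('a \<Rightarrow> real) \<Rightarrow> int \<Rightarrow> (int \<Rightarrow> 'a) \<Rightarrow> real" where
  "roof_sum L n x = (if n \<ge> 0 then (\<Sum>i\<in>{0..<n}. L (x i)) else - (\<Sum>i\<in>{n..<0}. L (x i)))"

text \<open>The flow T_t(x,s) = (x, s+t), read in the canonical representatives.\<close>
definition susp_flow :: "'a rsubst \<Rightarrow> ('a \<Rightarrow> real) \<Rightarrow> real \<Rightarrow>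
    (int \<Rightarrow> 'a) \<times> real \<Rightarrow> (int \<Rightarrow> 'a) \<times> real" where
  "susp_flow \<Theta> L t p = (THE q. q \<in> susp_reps \<Theta> L \<and>
      (\<exists>n::int. fst q = (\<lambda>i. fst p (i + n)) \<and> snd q = snd p + t - roof_sum L n (fst p)))"

definition open_cover :: "'b topology \<Rightarrow> 'b set set \<Rightarrow> bool" where
  "open_cover Y U \<longleftrightarrow> (\<forall>A\<in>U. openin Y A) \<and> \<Union>U = topspace Y"

definition min_subcover :: "'b topology \<Rightarrow> 'b set set \<Rightarrow> nat" where
  "min_subcover Y U = (LEAST k. \<exists>V. V \<subseteq> U \<and> finite V \<and> \<Union>V = topspace Y \<and> card V = k)"

definition join_cover :: "'b topology \<Rightarrow> ('b \<Rightarrow> 'b) \<Rightarrow> nat \<Rightarrow> 'b set set \<Rightarrow> 'b set set" where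
  "join_cover Y f n U = {topspace Y \<inter> (\<Inter>i<n. {y \<in> topspace Y. (f ^^ i) y \<in> A i}) | A. \<forall>i<n. A i \<in> U}"

definition cover_entropy :: "'b topology \<Rightarrow> ('b \<Rightarrow> 'b) \<Rightarrow> 'b set set \<Rightarrow> real" where
  "cover_entropy Y f U = lim (\<lambda>n. ln (real (min_subcover Y (join_cover Y f (Suc n) U))) / real (Suc n))"

definition top_entropy :: "'b topology \<Rightarrow> ('b \<Rightarrow> 'b) \<Rightarrow> ereal" where
  "top_entropy Y f = (SUP U \<in> {U. open_cover Y U}. ereal (cover_entropy Y f U))"

definition hull_entropy :: "'a rsubst \<Rightarrow> ('a \<Rightarrow> real) \<Rightarrow> ereal" where
  "hull_entropy \<Theta> L = top_entropy (Y_top \<Theta> L) (susp_flow \<Theta> L 1)"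

end

theory Submission
  imports Defs
begin

text \<open>
  All words in \<open>\<vartheta>\<^sup>m(a)\<close> have geometric length \<open>\<lambda>\<^sup>m L\<^sub>a\<close>, so a concatenation of images determines
  its factors and \<open>#\<vartheta>\<^sup>m(u)\<close> is the product of the \<open>#\<vartheta>\<^sup>m(u\<^sub>i)\<close>. Hence, for \<open>w \<in> \<vartheta>\<^sup>k(a)\<close>, the rate
  \<open>g\<^sub>m(a) = ln #\<vartheta>\<^sup>m(a) / (\<lambda>\<^sup>m L\<^sub>a)\<close> at level \<open>k + m\<close> dominates a weighted average over the letters of \<open>w\<close>
  of the rates at level \<open>m\<close>. The minimum over the letters is therefore nondecreasing, and by
  primitivity the maximum is squeezed to the same limit \<open>h\<close>.

  Upper bound: by a Lebesgue number argument, the \<open>n\<close>-fold join of an open cover has a subcover whose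
  size is, up to a constant factor, the number of legal words of geometric length at most
  \<open>n + const\<close>. Each such word sits inside an element of \<open>\<vartheta>\<^sup>m(u)\<close> with
  \<open>L(u) \<le> n / \<lambda>\<^sup>m + const\<close>, which bounds the exponential rate by
  \<open>max\<^sub>a g\<^sub>m(a) + const / \<lambda>\<^sup>m\<close> for every \<open>m\<close>.

  Lower bound: for a cover by sufficiently fine patches, the itinerary of \<open>(x, 0)\<close> over time \<open>n\<close>
  determines the tiles of \<open>x\<close> in \<open>[0, n]\<close>; so points carrying different words of \<open>\<vartheta>\<^sup>m(a)\<close> at the origin
  lie in different elements of the join as soon as \<open>n \<ge> \<lambda>\<^sup>m L\<^sub>a\<close>.
\<close>

section \<open>Subadditivity and the entropy of a cover\<close>

text \<open>Fekete's lemma; the limit is the infimum \<open>l\<close>. Indices are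
  \<open>Suc n\<close>, as in \<open>cover_entropy\<close>, so that no quotient divides by
  zero.\<close>

lemma subadditive_converges:
  fixes a :: "nat \<Rightarrow> real"
  assumes nonneg: "\<And>n. 0 \<le> a n" and sub: "\<And>m n. a (m + n) \<le> a m + a n"
  shows "convergent (\<lambda>n. a (Suc n) / real (Suc n))"
proof -
  define l where "l = (INF n. a (Suc n) / real (Suc n))"
  have bdd: "bdd_below (range (\<lambda>n. a (Suc n) / real (Suc n)))"
    using nonneg by (intro bdd_belowI[of _ 0]) auto
  have lower: "l \<le> a (Suc n) / real (Suc n)" for n
    unfolding l_def by (rule cINF_lower[OF bdd]) simp
  have mult: "a (q * k + r) \<le> real q * a k + a r" for q k r
  proof (induction q)
    case (Suc q)
    then show ?case
      using sub[of k "q * k + r"] by (simp add: algebra_simps)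
  qed simp
  have "(\<lambda>n. a (Suc n) / real (Suc n)) \<longlonglongrightarrow> l"
  proof (rule LIMSEQ_I)
    fix e :: real assume e: "e > 0"
    have "\<exists>n. a (Suc n) / real (Suc n) < l + e / 2"
      using cINF_less_iff[OF _ bdd, of "l + e / 2"] e by (auto simp: l_def)
    then obtain k' where k': "a (Suc k') / real (Suc k') < l + e / 2"
      by blast
    define k where "k = Suc k'"
    define M where "M = (\<Sum>i<k. a i)"
    have "M \<ge> 0"
      unfolding M_def by (intro sum_nonneg nonneg)
    obtain n0 where n0: "real n0 > 2 * M / e"
      using reals_Archimedean2 by blast
    have upper: "a (Suc n) / real (Suc n) < l + e" if "n \<ge> n0" for n
    proof -
      have k: "k > 0"
        by (simp add: k_def)
      \<comment> \<open>Cut \<open>Suc n\<close> into \<open>q\<close> blocks of length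
        \<open>k\<close>, where \<open>a k / k\<close> is within \<open>e / 2\<close> of
        \<open>l\<close>; the remainder costs at most \<open>M\<close>, which does not depend on
        \<open>n\<close>.\<close>
      define q r where "q = Suc n div k" and "r = Suc n mod k"
      have n: "Suc n = q * k + r" and r: "r < k"
        using k by (auto simp: q_def r_def)
      have "a r \<le> M"
        unfolding M_def by (rule member_le_sum) (use r nonneg in auto)
      then have "a (Suc n) \<le> real q * a k + M"
        using mult[of q k r] n by simp
      also have "real q * a k = (real q * real k) * (a k / real k)"
        using k by simp
      also have "\<dots> \<le> real (Suc n) * (a k / real k)"
        unfolding n using nonneg[of k] by (intro mult_right_mono) auto
      finally have "a (Suc n) \<le> real (Suc n) * (a k / real k) + M"
        by simp
      then have "a (Suc n) / real (Suc n) \<le> (real (Suc n) * (a k / real k) + M) / real (Suc n)"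
        by (rule divide_right_mono) simp
      also have "\<dots> = a k / real k + M / real (Suc n)"
        by (simp add: add_divide_distrib del: of_nat_Suc)
      finally have "a (Suc n) / real (Suc n) \<le> a k / real k + M / real (Suc n)" .
      moreover have "M / real (Suc n) < e / 2"
      proof -
        have "real (Suc n) > 2 * M / e"
          using n0 that by simp
        then show ?thesis
          using e by (simp add: field_simps)
      qed
      ultimately show ?thesis
        using k' unfolding k_def by linarith
    qed
    have "norm (a (Suc n) / real (Suc n) - l) < e" if "n \<ge> n0" for n
      using upper[OF that] lower[of n] e unfolding real_norm_def by linarith
    then show "\<exists>no. \<forall>n\<ge>no. norm (a (Suc n) / real (Suc n) - l) < e"
      by blast
  qed
  then show ?thesis
    by (rule convergentI)
qed

section \<open>Finite subcovers and their growth under joins\<close>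

definition has_finite_subcover :: "'b topology \<Rightarrow> 'b set set \<Rightarrow> bool" where
  "has_finite_subcover Y U \<longleftrightarrow> (\<exists>V. V \<subseteq> U \<and> finite V \<and> \<Union>V = topspace Y)"

lemma min_subcover_le:
  assumes "V \<subseteq> U" "finite V" "\<Union>V = topspace Y"
  shows "min_subcover Y U \<le> card V"
  unfolding min_subcover_def by (rule Least_le) (use assms in blast)

text \<open>\<open>min_subcover\<close> is a \<open>LEAST\<close>, hence meaningful only when a
  finite subcover exists; for joined covers \<open>join_cover_classes\<close> supplies one.\<close>

lemma min_subcover_attained:
  assumes "has_finite_subcover Y U"
  obtains V where "V \<subseteq> U" "finite V" "\<Union>V = topspace Y" "card V = min_subcover Y U"
proof -
  have "\<exists>k. \<exists>V. V \<subseteq> U \<and> finite V \<and> \<Union>V = topspace Y \<and> card V = k"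
    using assms by (auto simp: has_finite_subcover_def)
  from LeastI_ex[OF this] show thesis
    using that by (auto simp: min_subcover_def)
qed

lemma min_subcover_pos:
  assumes "has_finite_subcover Y U" "topspace Y \<noteq> {}"
  shows "min_subcover Y U > 0"
proof -
  obtain V where "V \<subseteq> U" "finite V" "\<Union>V = topspace Y" "card V = min_subcover Y U"
    using min_subcover_attained[OF assms(1)] .
  then show ?thesis
    using assms(2) by (metis card_gt_0_iff Union_empty)
qed

text \<open>Source of the upper bounds on \<open>min_subcover\<close>: pick one representative per
  value of \<open>\<Phi>\<close>; the cover element chosen for it contains its whole fibre.\<close>

lemma finite_classes_imp_subcover:
  assumes "finite F" "\<Phi> ` topspace Y \<subseteq> F" "\<And>A. A \<in> U \<Longrightarrow> A \<subseteq> topspace Y"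
    and "\<And>y. y \<in> topspace Y \<Longrightarrow> \<exists>A\<in>U. \<forall>y'\<in>topspace Y. \<Phi> y' = \<Phi> y \<longrightarrow> y' \<in> A"
  shows "has_finite_subcover Y U" and "min_subcover Y U \<le> card F"
proof -
  obtain A where A: "\<And>y. y \<in> topspace Y \<Longrightarrow> A y \<in> U"
      "\<And>y y'. y \<in> topspace Y \<Longrightarrow> y' \<in> topspace Y \<Longrightarrow> \<Phi> y' = \<Phi> y \<Longrightarrow> y' \<in> A y"
    using assms(4) by metis
  define r where "r = inv_into (topspace Y) \<Phi>"
  have r: "r (\<Phi> y) \<in> topspace Y" "\<Phi> (r (\<Phi> y)) = \<Phi> y" if "y \<in> topspace Y" for y
    using that by (auto simp: r_def inv_into_into f_inv_into_f)
  define V where "V = (\<lambda>c. A (r c)) ` \<Phi> ` topspace Y"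
  have V: "V \<subseteq> U" "finite V"
    using A(1) r(1) finite_subset[OF assms(2,1)] by (auto simp: V_def)
  have "y \<in> \<Union>V" if "y \<in> topspace Y" for y
    using A(2)[of "r (\<Phi> y)" y] r[OF that] that by (auto simp: V_def)
  then have cov: "\<Union>V = topspace Y"
    using V(1) assms(3) by blast
  show "has_finite_subcover Y U"
    using V cov by (auto simp: has_finite_subcover_def)
  have "card V \<le> card (\<Phi> ` topspace Y)"
    unfolding V_def by (rule card_image_le) (use finite_subset[OF assms(2,1)] in auto)
  also have "\<dots> \<le> card F"
    by (rule card_mono[OF assms(1,2)])
  finally show "min_subcover Y U \<le> card F"
    using min_subcover_le[OF V cov] by linarith
qed

text \<open>Source of the lower bounds: an element of a subcover contains \<open>f v\<close> for at
  most one \<open>v\<close>, so assigning to each \<open>v\<close> an element that contains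
  \<open>f v\<close> is injective.\<close>

lemma separated_card_le_min_subcover:
  assumes "has_finite_subcover Y U" "f ` S \<subseteq> topspace Y"
    and sep: "\<And>A v w. A \<in> U \<Longrightarrow> v \<in> S \<Longrightarrow> w \<in> S \<Longrightarrow> f v \<in> A \<Longrightarrow> f w \<in> A \<Longrightarrow> v = w"
  shows "card S \<le> min_subcover Y U"
proof -
  obtain V where V: "V \<subseteq> U" "finite V" "\<Union>V = topspace Y" "card V = min_subcover Y U"
    using min_subcover_attained[OF assms(1)] .
  have "\<forall>v\<in>S. \<exists>A\<in>V. f v \<in> A"
    using V(3) assms(2) by blast
  then obtain A where A: "\<And>v. v \<in> S \<Longrightarrow> A v \<in> V" "\<And>v. v \<in> S \<Longrightarrow> f v \<in> A v"
    by metis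
  have "inj_on A S"
  proof (rule inj_onI)
    fix v w assume "v \<in> S" "w \<in> S" "A v = A w"
    then show "v = w"
      using sep[of "A v" v w] A V(1) by (metis subsetD)
  qed
  then have "card S \<le> card V"
    by (rule card_inj_on_le) (use A V in auto)
  then show ?thesis
    by (simp add: V)
qed

lemma join_cover_iff:
  "J \<in> join_cover Y f n U \<longleftrightarrow>
    (\<exists>A. J = {y \<in> topspace Y. \<forall>i<n. (f ^^ i) y \<in> A i} \<and> (\<forall>i<n. A i \<in> U))"
proof -
  have eq: "topspace Y \<inter> (\<Inter>i<n. {y \<in> topspace Y. (f ^^ i) y \<in> A i})
      = {y \<in> topspace Y. \<forall>i<n. (f ^^ i) y \<in> A i}" for A
    by auto
  show ?thesis
    unfolding join_cover_def eq mem_Collect_eq ..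
qed

text \<open>Intersecting an element of the \<open>m\<close>-fold join with the preimage under
  \<open>f ^^ m\<close> of an element of the \<open>n\<close>-fold join gives an element of the
  longer join.\<close>

lemma min_subcover_join_submult:
  assumes f: "\<And>y. y \<in> topspace Y \<Longrightarrow> f y \<in> topspace Y"
    and fin: "\<And>n. has_finite_subcover Y (join_cover Y f n U)"
  shows "min_subcover Y (join_cover Y f (m + n) U)
       \<le> min_subcover Y (join_cover Y f m U) * min_subcover Y (join_cover Y f n U)"
proof -
  obtain V where V: "V \<subseteq> join_cover Y f m U" "finite V" "\<Union>V = topspace Y"
      "card V = min_subcover Y (join_cover Y f m U)"
    using min_subcover_attained[OF fin] .
  obtain W where W: "W \<subseteq> join_cover Y f n U" "finite W" "\<Union>W = topspace Y"
      "card W = min_subcover Y (join_cover Y f n U)"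
    using min_subcover_attained[OF fin] .
  have fpow: "(f ^^ i) y \<in> topspace Y" if "y \<in> topspace Y" for i y
    using that by (induction i) (auto intro: f)
  define J where "J = (\<lambda>(A, B). A \<inter> {y \<in> topspace Y. (f ^^ m) y \<in> B})"
  have "J (A, B) \<in> join_cover Y f (m + n) U" if "A \<in> V" "B \<in> W" for A B
  proof -
    have "A \<in> join_cover Y f m U" "B \<in> join_cover Y f n U"
      using that V(1) W(1) by auto
    then obtain A' B' where A: "A = {y \<in> topspace Y. \<forall>i<m. (f ^^ i) y \<in> A' i}" "\<forall>i<m. A' i \<in> U"
        and B: "B = {y \<in> topspace Y. \<forall>i<n. (f ^^ i) y \<in> B' i}" "\<forall>i<n. B' i \<in> U"
      unfolding join_cover_iff by (elim exE conjE)
    define C where "C i = (if i < m then A' i else B' (i - m))" for i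
    have C: "\<forall>i<m + n. C i \<in> U"
      using A(2) B(2) by (auto simp: C_def)
    have all_C: "(\<forall>i<m + n. (f ^^ i) y \<in> C i) \<longleftrightarrow>
        (\<forall>i<m. (f ^^ i) y \<in> A' i) \<and> (\<forall>i<n. (f ^^ (i + m)) y \<in> B' i)" for y
    proof (intro iffI conjI allI impI)
      fix i assume *: "\<forall>i<m + n. (f ^^ i) y \<in> C i"
      show "(f ^^ i) y \<in> A' i" if "i < m"
        using *[rule_format, of i] that by (simp add: C_def)
      show "(f ^^ (i + m)) y \<in> B' i" if "i < n"
        using *[rule_format, of "i + m"] that by (simp add: C_def)
    next
      fix i assume *: "(\<forall>i<m. (f ^^ i) y \<in> A' i) \<and> (\<forall>i<n. (f ^^ (i + m)) y \<in> B' i)" and i: "i < m + n"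
      show "(f ^^ i) y \<in> C i"
        using * i conjunct2[OF *, rule_format, of "i - m"] by (cases "i < m") (auto simp: C_def)
    qed
    have "J (A, B) = {y \<in> topspace Y. (\<forall>i<m. (f ^^ i) y \<in> A' i) \<and> (\<forall>i<n. (f ^^ (i + m)) y \<in> B' i)}"
      unfolding J_def A(1) B(1) using fpow by (auto simp: funpow_add)
    with C show ?thesis
      unfolding join_cover_iff all_C[symmetric] by (intro exI conjI)
  qed
  then have 1: "J ` (V \<times> W) \<subseteq> join_cover Y f (m + n) U"
    by auto
  have 2: "\<Union>(J ` (V \<times> W)) = topspace Y"
  proof (intro equalityI subsetI)
    fix y assume y: "y \<in> topspace Y"
    then obtain A B where "A \<in> V" "y \<in> A" "B \<in> W" "(f ^^ m) y \<in> B"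
      using V(3) W(3) fpow[OF y, of m] by blast
    with y show "y \<in> \<Union>(J ` (V \<times> W))"
      by (auto simp: J_def)
  qed (auto simp: J_def)
  have "min_subcover Y (join_cover Y f (m + n) U) \<le> card (J ` (V \<times> W))"
    using V(2) W(2) by (intro min_subcover_le[OF 1 _ 2]) auto
  also have "\<dots> \<le> card (V \<times> W)"
    by (rule card_image_le) (use V(2) W(2) in auto)
  finally show ?thesis
    by (simp add: V W card_cartesian_product)
qed

text \<open>\<open>cover_entropy\<close> is a \<open>lim\<close>, which carries information only
  under convergence. The logarithms of the counts are subadditive, and nonnegative because the
  counts are positive, so Fekete's lemma applies.\<close>

lemma cover_entropy_tendsto:
  assumes f: "\<And>y. y \<in> topspace Y \<Longrightarrow> f y \<in> topspace Y" and "topspace Y \<noteq> {}"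
    and fin: "\<And>n. has_finite_subcover Y (join_cover Y f n U)"
  shows "(\<lambda>n. ln (real (min_subcover Y (join_cover Y f (Suc n) U))) / real (Suc n))
      \<longlonglongrightarrow> cover_entropy Y f U"
proof -
  let ?N = "\<lambda>n. min_subcover Y (join_cover Y f n U)"
  have pos: "?N n > 0" for n
    by (rule min_subcover_pos[OF fin assms(2)])
  have "convergent (\<lambda>n. ln (real (?N (Suc n))) / real (Suc n))"
  proof (rule subadditive_converges)
    show "0 \<le> ln (real (?N n))" for n
      using pos[of n] by simp
    show "ln (real (?N (m + n))) \<le> ln (real (?N m)) + ln (real (?N n))" for m n
    proof -
      have "real (?N (m + n)) \<le> real (?N m * ?N n)"
        using min_subcover_join_submult[where m = m and n = n, OF f fin] by (rule of_nat_mono)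
      then have "ln (real (?N (m + n))) \<le> ln (real (?N m) * real (?N n))"
        using pos[of "m + n"] by simp
      then show ?thesis
        using pos[of m] pos[of n] by (simp add: ln_mult)
    qed
  qed
  then show ?thesis
    unfolding cover_entropy_def by (simp add: convergent_LIMSEQ_iff)
qed

section \<open>Random substitutions and geometric length\<close>

text \<open>The geometric length L(w), summed along the word instead of over letter counts, so that
  additivity under append is immediate.\<close>

definition wlen :: "('a \<Rightarrow> real) \<Rightarrow> 'a list \<Rightarrow> real" where
  "wlen L w = sum_list (map L w)"

lemma wlen_simps [simp]:
  "wlen L [] = 0" "wlen L (a # w) = L a + wlen L w" "wlen L (v @ w) = wlen L v + wlen L w"
  by (simp_all add: wlen_def)

text \<open>\<open>geom_compatible_data\<close> speaks of letter counts; this turns the left side of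
  its eigenvector equation into the length of an image.\<close>

lemma sum_count_list_eq_wlen:
  fixes L :: "'a::finite \<Rightarrow> real"
  shows "(\<Sum>a\<in>UNIV. L a * real (count_list w a)) = wlen L w"
proof (induction w)
  case (Cons b w)
  have "(\<Sum>a\<in>UNIV. L a * real (count_list (b # w) a))
      = (\<Sum>a\<in>UNIV. L a * real (count_list w a) + (if a = b then L b else 0))"
    by (intro sum.cong) (auto simp: algebra_simps)
  with Cons show ?case
    by (simp add: sum.distrib)
qed simp

lemma subst_word_Nil [simp]: "subst_word \<Theta> [] = {[]}"
  by (auto simp: subst_word_def)

lemma subst_word_Cons:
  "subst_word \<Theta> (a # u) = (\<lambda>(v, w). v @ w) ` (\<Theta> a \<times> subst_word \<Theta> u)"
proof (intro equalityI subsetI)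
  fix x assume "x \<in> subst_word \<Theta> (a # u)"
  then obtain v ws where "x = v @ concat ws" "v \<in> \<Theta> a" "list_all2 (\<lambda>w a. w \<in> \<Theta> a) ws u"
    by (auto simp: subst_word_def list_all2_Cons2)
  then show "x \<in> (\<lambda>(v, w). v @ w) ` (\<Theta> a \<times> subst_word \<Theta> u)"
    by (auto simp: subst_word_def)
next
  fix x assume "x \<in> (\<lambda>(v, w). v @ w) ` (\<Theta> a \<times> subst_word \<Theta> u)"
  then obtain v ws where "x = concat (v # ws)" "list_all2 (\<lambda>w a. w \<in> \<Theta> a) (v # ws) (a # u)"
    by (auto simp: subst_word_def)
  then show "x \<in> subst_word \<Theta> (a # u)"
    unfolding subst_word_def by blast
qed

lemma subst_word_ConsI: "v \<in> \<Theta> a \<Longrightarrow> w \<in> subst_word \<Theta> u \<Longrightarrow> v @ w \<in> subst_word \<Theta> (a # u)"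
  by (force simp: subst_word_Cons)

lemma subst_word_ConsE:
  assumes "x \<in> subst_word \<Theta> (a # u)"
  obtains v w where "x = v @ w" "v \<in> \<Theta> a" "w \<in> subst_word \<Theta> u"
  using assms by (auto simp: subst_word_Cons)

lemma subst_word_single [simp]: "subst_word \<Theta> [a] = \<Theta> a"
  by (force simp: subst_word_Cons)

lemma subst_word_appendI:
  "v \<in> subst_word \<Theta> u \<Longrightarrow> v' \<in> subst_word \<Theta> u' \<Longrightarrow> v @ v' \<in> subst_word \<Theta> (u @ u')"
proof (induction u arbitrary: v)
  case (Cons a u)
  then obtain y z where "v = y @ z" "y \<in> \<Theta> a" "z @ v' \<in> subst_word \<Theta> (u @ u')"
    by (auto elim!: subst_word_ConsE)
  then show ?case
    using subst_word_ConsI by fastforce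
qed simp

lemma subst_word_appendE:
  assumes "x \<in> subst_word \<Theta> (u @ u')"
  obtains v v' where "x = v @ v'" "v \<in> subst_word \<Theta> u" "v' \<in> subst_word \<Theta> u'"
proof -
  have "\<exists>v v'. x = v @ v' \<and> v \<in> subst_word \<Theta> u \<and> v' \<in> subst_word \<Theta> u'"
    using assms
  proof (induction u arbitrary: x)
    case (Cons a u)
    then obtain v w where vw: "x = v @ w" "v \<in> \<Theta> a" "w \<in> subst_word \<Theta> (u @ u')"
      by (auto elim: subst_word_ConsE)
    with Cons.IH obtain v1 v2 where "w = v1 @ v2" "v1 \<in> subst_word \<Theta> u" "v2 \<in> subst_word \<Theta> u'"
      by blast
    with vw show ?case
      by (metis append_assoc subst_word_ConsI)
  qed simp
  with that show thesis by blast
qed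

text \<open>Letters choose their images independently, also at the intermediate level, so extension
  to words commutes with composition. This lets \<open>subst_pow\<close> be split at any
  level.\<close>

lemma subst_word_UN:
  "subst_word (\<lambda>a. \<Union>v \<in> \<Phi> a. subst_word \<Theta> v) u = (\<Union>v \<in> subst_word \<Phi> u. subst_word \<Theta> v)"
proof (induction u)
  case (Cons a u)
  show ?case
  proof (intro equalityI subsetI)
    fix x assume "x \<in> subst_word (\<lambda>a. \<Union>v \<in> \<Phi> a. subst_word \<Theta> v) (a # u)"
    then obtain y z v v' where "x = y @ z" "v \<in> \<Phi> a" "y \<in> subst_word \<Theta> v"
        "v' \<in> subst_word \<Phi> u" "z \<in> subst_word \<Theta> v'"
      using Cons by (auto elim!: subst_word_ConsE)
    then show "x \<in> (\<Union>v \<in> subst_word \<Phi> (a # u). subst_word \<Theta> v)"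
      by (auto intro!: bexI[of _ "v @ v'"] subst_word_appendI subst_word_ConsI)
  next
    fix x assume "x \<in> (\<Union>v \<in> subst_word \<Phi> (a # u). subst_word \<Theta> v)"
    then obtain v v' where v: "v \<in> \<Phi> a" "v' \<in> subst_word \<Phi> u" and x: "x \<in> subst_word \<Theta> (v @ v')"
      by (auto elim!: subst_word_ConsE)
    from x obtain y z where "x = y @ z" "y \<in> subst_word \<Theta> v" "z \<in> subst_word \<Theta> v'"
      by (rule subst_word_appendE)
    then show "x \<in> subst_word (\<lambda>a. \<Union>v \<in> \<Phi> a. subst_word \<Theta> v) (a # u)"
      using v Cons by (auto intro!: subst_word_ConsI)
  qed
qed simp

lemma subst_pow_add:
  "subst_pow \<Theta> (n + m) a = (\<Union>u \<in> subst_pow \<Theta> n a. subst_word (subst_pow \<Theta> m) u)"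
proof (induction m arbitrary: a)
  case 0
  have "subst_word (\<lambda>a. {[a]}) u = {u}" for u :: "'a list"
    by (induction u) (auto simp: subst_word_Cons)
  moreover have "subst_pow \<Theta> 0 = (\<lambda>a. {[a]})"
    by (rule ext) simp
  ultimately show ?case
    by simp
next
  case (Suc m)
  have eq: "subst_pow \<Theta> (Suc m) = (\<lambda>a. \<Union>v \<in> subst_pow \<Theta> m a. subst_word \<Theta> v)"
    by (rule ext) simp
  show ?case
    unfolding eq subst_word_UN using Suc by simp
qed

lemma subst_pow_addI:
  "u \<in> subst_pow \<Theta> n a \<Longrightarrow> v \<in> subst_word (subst_pow \<Theta> m) u \<Longrightarrow> v \<in> subst_pow \<Theta> (n + m) a"
  by (auto simp: subst_pow_add)

lemma finite_subst_word: "(\<And>a. finite (\<Theta> a)) \<Longrightarrow> finite (subst_word \<Theta> u)"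
  by (induction u) (auto simp: subst_word_Cons)

lemma subst_word_nonempty: "(\<And>a. \<Theta> a \<noteq> {}) \<Longrightarrow> subst_word \<Theta> u \<noteq> {}"
  by (induction u) (auto simp: subst_word_Cons)

lemma length_subst_word:
  assumes "\<And>a. [] \<notin> \<Theta> a" "v \<in> subst_word \<Theta> u"
  shows "length u \<le> length v"
  using assms(2)
proof (induction u arbitrary: v)
  case (Cons a u)
  then obtain y z where "v = y @ z" "y \<in> \<Theta> a" "z \<in> subst_word \<Theta> u"
    by (auto elim: subst_word_ConsE)
  moreover from this have "y \<noteq> []" "length u \<le> length z"
    using assms(1)[of a] Cons.IH by auto
  ultimately show ?case
    by (cases y) auto
qed simp

lemma random_subst_pow:
  assumes "random_subst \<Theta>"
  shows "random_subst (subst_pow \<Theta> n)"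
proof (induction n)
  case 0
  show ?case by (simp add: random_subst_def)
next
  case (Suc n)
  have \<Theta>: "finite (\<Theta> a)" "\<Theta> a \<noteq> {}" "[] \<notin> \<Theta> a" for a
    using assms by (auto simp: random_subst_def)
  have Nil: "[] \<notin> subst_word \<Theta> u" if "u \<noteq> []" for u
    using length_subst_word[of \<Theta> "[]" u] \<Theta> that by auto
  show ?case
    unfolding random_subst_def
  proof (intro allI conjI)
    fix a
    have IH: "finite (subst_pow \<Theta> n a)" "subst_pow \<Theta> n a \<noteq> {}" "[] \<notin> subst_pow \<Theta> n a"
      using Suc by (auto simp: random_subst_def)
    show "finite (subst_pow \<Theta> (Suc n) a)"
      using IH \<Theta> by (auto intro!: finite_subst_word)
    show "subst_pow \<Theta> (Suc n) a \<noteq> {}"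
      using IH \<Theta> subst_word_nonempty[of \<Theta>] by auto
    show "[] \<notin> subst_pow \<Theta> (Suc n) a"
      using IH Nil by auto metis
  qed
qed

lemma wlen_subst_word:
  assumes "\<And>a w. w \<in> \<Phi> a \<Longrightarrow> wlen L w = c * L a" "v \<in> subst_word \<Phi> u"
  shows "wlen L v = c * wlen L u"
  using assms(2)
  by (induction u arbitrary: v) (auto elim!: subst_word_ConsE simp: assms(1) algebra_simps)

section \<open>Letters occurring in high powers of a primitive substitution\<close>

lemma concat_map_mem_subst_word:
  "(\<And>a. \<theta> a \<in> \<Phi> a) \<Longrightarrow> concat (map \<theta> u) \<in> subst_word \<Phi> u"
  by (induction u) (auto intro: subst_word_ConsI)

text \<open>A positive entry of a power of the matrix of the marginal \<open>\<theta>\<close>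
  exhibits a letter in an iterated image under \<open>\<theta>\<close>. Levels above
  \<open>n * k\<close> are reached by performing the surplus steps first.\<close>

lemma primitive_imp_full_words:
  fixes \<Theta> :: "('a::finite) rsubst"
  assumes rs: "random_subst \<Theta>" and "primitive_rsubst \<Theta>"
  obtains N where "\<And>p a. p \<ge> N \<Longrightarrow> \<exists>w \<in> subst_pow \<Theta> p a. set w = UNIV"
proof -
  obtain n \<theta> k where \<theta>: "\<And>a. \<theta> a \<in> subst_pow \<Theta> n a"
      and k: "\<And>a b. mat_pow (subst_matrix \<theta>) k a b > 0"
    using assms by (auto simp: primitive_rsubst_def primitive_matrix_def marginal_of_def)
  \<comment> \<open>\<open>tw j b\<close> is the \<open>j\<close>-fold iterate of
    \<open>\<theta>\<close> on \<open>b\<close>, one particular word of level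
    \<open>n * j\<close>.\<close>
  define tw where "tw = rec_nat (\<lambda>b. [b]) (\<lambda>j f b. concat (map \<theta> (f b)))"
  have tw_simps: "tw 0 b = [b]" "tw (Suc j) b = concat (map \<theta> (tw j b))" for b j
    by (simp_all add: tw_def)
  have tw_mem: "tw j b \<in> subst_pow \<Theta> (n * j) b" for j b
  proof (induction j)
    case (Suc j)
    have "tw (Suc j) b \<in> subst_pow \<Theta> (n * j + n) b"
      unfolding tw_simps
      by (rule subst_pow_addI[OF Suc]) (rule concat_map_mem_subst_word[OF \<theta>])
    then show ?case by (simp add: add.commute)
  qed (simp add: tw_simps)
  have "mat_pow (subst_matrix \<theta>) j a b > 0 \<Longrightarrow> a \<in> set (tw j b)" for j a b
  proof (induction j arbitrary: a)
    case (Suc j)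
    then obtain c where "subst_matrix \<theta> a c * mat_pow (subst_matrix \<theta>) j c b > 0"
      by (auto simp: neq0_conv[symmetric] simp del: neq0_conv)
    then have "subst_matrix \<theta> a c > 0" and "c \<in> set (tw j b)"
      using Suc.IH by auto
    moreover from this have "a \<in> set (\<theta> c)"
      by (metis count_notin less_irrefl subst_matrix_def)
    ultimately show ?case
      by (auto simp: tw_simps)
  qed (auto simp: tw_simps split: if_splits)
  then have full: "set (tw k b) = UNIV" for b
    using k by blast
  have "\<exists>w \<in> subst_pow \<Theta> p a. set w = UNIV" if "p \<ge> n * k" for p a
  proof -
    have "random_subst (subst_pow \<Theta> (p - n * k))"
      by (rule random_subst_pow[OF rs])
    then obtain u where u: "u \<in> subst_pow \<Theta> (p - n * k) a" "u \<noteq> []"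
      unfolding random_subst_def by (metis all_not_in_conv)
    have "concat (map (tw k) u) \<in> subst_pow \<Theta> ((p - n * k) + n * k) a"
      by (rule subst_pow_addI[OF u(1)]) (rule concat_map_mem_subst_word[OF tw_mem])
    moreover have "set (concat (map (tw k) u)) = UNIV"
      using u(2) full by (cases u) auto
    ultimately show ?thesis
      using that by force
  qed
  with that show thesis by blast
qed

section \<open>Lengths of images and a priori word counts\<close>

locale geom_rsubst =
  fixes \<Theta> :: "('a::finite) rsubst" and lam :: real and L :: "'a \<Rightarrow> real"
  assumes rs: "random_subst \<Theta>"
    and prim: "primitive_rsubst \<Theta>"
    and geom: "geom_compatible_data \<Theta> lam L"
begin

definition "Lmin = Min (range L)"
definition "Lmax = Max (range L)"

lemma L_pos [simp]: "L a > 0" and lam_gt_1: "lam > 1"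
  using geom by (auto simp: geom_compatible_data_def)

lemma Lmin_pos [simp]: "Lmin > 0" and Lmin_le [simp]: "Lmin \<le> L a" and L_le_Lmax [simp]: "L a \<le> Lmax"
  by (auto simp: Lmin_def Lmax_def)

lemma Lmin_le_Lmax: "Lmin \<le> Lmax"
  using Lmin_le L_le_Lmax order_trans by blast

lemma Lmax_pos [simp]: "Lmax > 0"
  using Lmin_pos Lmin_le_Lmax by linarith

lemma lam_pos [simp]: "lam > 0"
  using lam_gt_1 by simp

lemma nonneg_nonzero [simp]:
  "lam \<ge> 0" "L a \<ge> 0" "Lmin \<ge> 0" "Lmax \<ge> 0" "lam \<noteq> 0" "L a \<noteq> 0" "Lmin \<noteq> 0" "Lmax \<noteq> 0"
  using lam_pos L_pos[of a] Lmin_pos Lmax_pos by linarith+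

lemma wlen_nonneg [simp]: "wlen L w \<ge> 0"
  by (induction w) (auto simp: add_nonneg_nonneg less_imp_le)

lemma wlen_ge: "Lmin * length w \<le> wlen L w"
  by (induction w) (auto simp: algebra_simps add_mono)

lemma wlen_le: "wlen L w \<le> Lmax * length w"
  by (induction w) (auto simp: algebra_simps add_mono)

lemma wlen_eq_0_iff [simp]: "wlen L w = 0 \<longleftrightarrow> w = []"
proof (cases w)
  case (Cons a v)
  then show ?thesis using L_pos[of a] wlen_nonneg[of v] by (simp del: L_pos wlen_nonneg)
qed simp

text \<open>Any \<open>w\<close> in \<open>\<Theta> a\<close> is the value at \<open>a\<close> of
  some marginal: override an arbitrary marginal at \<open>a\<close>. Column \<open>a\<close> of the
  eigenvector equation then computes the length of \<open>w\<close>.\<close>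

lemma wlen_image:
  assumes "w \<in> \<Theta> a"
  shows "wlen L w = lam * L a"
proof -
  have "\<forall>b. \<exists>v. v \<in> \<Theta> b"
    using rs by (auto simp: random_subst_def)
  then obtain \<theta> where "\<And>b. \<theta> b \<in> \<Theta> b"
    by metis
  then have "marginal_of \<Theta> (\<theta>(a := w))"
    using assms by (auto simp: marginal_of_def)
  then have "(\<Sum>c\<in>UNIV. L c * real (subst_matrix (\<theta>(a := w)) c a)) = lam * L a"
    using geom by (auto simp: geom_compatible_data_def)
  then show ?thesis
    by (simp add: subst_matrix_def sum_count_list_eq_wlen)
qed

lemma wlen_subst_pow: "v \<in> subst_pow \<Theta> m a \<Longrightarrow> wlen L v = lam ^ m * L a"
proof (induction m arbitrary: v)
  case (Suc m)
  then obtain u where "u \<in> subst_pow \<Theta> m a" "v \<in> subst_word \<Theta> u"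
    by auto
  with Suc.IH wlen_subst_word[OF wlen_image] show ?case
    by fastforce
qed simp

lemma wlen_subst_word_pow: "v \<in> subst_word (subst_pow \<Theta> m) u \<Longrightarrow> wlen L v = lam ^ m * wlen L u"
  by (rule wlen_subst_word[OF wlen_subst_pow])

lemma pow_finite [simp]: "finite (subst_pow \<Theta> m a)"
  and pow_nonempty [simp]: "subst_pow \<Theta> m a \<noteq> {}"
  and pow_Nil [simp]: "[] \<notin> subst_pow \<Theta> m a"
  using random_subst_pow[OF rs] by (auto simp: random_subst_def)

lemma card_pow_pos [simp]: "card (subst_pow \<Theta> m a) > 0"
  by (simp add: card_gt_0_iff)

text \<open>The images of a letter have equal geometric length and all tiles are positive, so a
  concatenation of images determines its factors.\<close>

lemma append_eq_wlen_cancel: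
  assumes "v @ w = v' @ w'" "wlen L v = wlen L v'"
  shows "v = v' \<and> w = w'"
proof -
  from assms(1) consider us where "v = v' @ us" "us @ w = w'" | us where "v' = v @ us" "w = us @ w'"
    by (auto simp: append_eq_append_conv2)
  then show ?thesis
    using assms(2) by cases auto
qed

text \<open>The first factors all have length \<open>lam ^ m * L a\<close>, so concatenation is
  injective by \<open>append_eq_wlen_cancel\<close> and the counts multiply.\<close>

lemma card_subst_word_pow:
  "card (subst_word (subst_pow \<Theta> m) u) = prod_list (map (\<lambda>a. card (subst_pow \<Theta> m a)) u)"
proof (induction u)
  case (Cons a u)
  have "inj_on (\<lambda>(v, w). v @ w) (subst_pow \<Theta> m a \<times> subst_word (subst_pow \<Theta> m) u)"
    by (auto simp: inj_on_def wlen_subst_pow dest: append_eq_wlen_cancel)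
  with Cons show ?case
    by (simp add: subst_word_Cons card_image card_cartesian_product)
qed simp

text \<open>A crude exponential growth rate, per unit of geometric length, for all words over the
  alphabet, legal or not.\<close>

definition "\<kappa> = ln (real CARD('a) + 1) / Lmin"

text \<open>Such words have at most \<open>r / Lmin\<close> letters. For negative \<open>r\<close>
  the set is empty, and \<open>max r 0\<close> keeps the exponent nonnegative.\<close>

lemma words_bounded_wlen:
  shows "finite {u. wlen L u \<le> r}" and "real (card {u. wlen L u \<le> r}) \<le> exp (\<kappa> * max r 0)"
proof -
  define n where "n = nat \<lfloor>r / Lmin\<rfloor>"
  have "length u \<le> n" if "wlen L u \<le> r" for u
  proof -
    have "real (length u) \<le> r / Lmin"
      using wlen_ge[of u] that by (simp add: field_simps)
    then show ?thesis
      by (simp add: n_def le_nat_floor)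
  qed
  then have sub: "{u. wlen L u \<le> r} \<subseteq> {u. set u \<subseteq> UNIV \<and> length u \<le> n}"
    by auto
  have fin: "finite {u. set u \<subseteq> (UNIV :: 'a set) \<and> length u \<le> n}"
    by (rule finite_lists_length_le) simp
  then show "finite {u. wlen L u \<le> r}"
    using sub finite_subset by blast
  have geo: "(\<Sum>i\<le>j. c ^ i) \<le> (c + 1) ^ j" for c j :: nat
  proof (induction j)
    case (Suc j)
    have "c * c ^ j \<le> c * (c + 1) ^ j"
      by (intro mult_left_mono power_mono) auto
    with Suc have "c * c ^ j + (\<Sum>i\<le>j. c ^ i) \<le> c * (c + 1) ^ j + (c + 1) ^ j"
      by (rule add_mono[rotated])
    then show ?case
      by (simp add: algebra_simps)
  qed simp
  have "card {u. wlen L u \<le> r} \<le> (CARD('a) + 1) ^ n"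
    using card_mono[OF fin sub] card_lists_length_le[of "UNIV :: 'a set" n] geo[where c = "CARD('a)" and j = n]
    by simp
  then have "real (card {u. wlen L u \<le> r}) \<le> (real CARD('a) + 1) ^ n"
    by (metis of_nat_1 of_nat_add of_nat_le_iff of_nat_power)
  also have "\<dots> = exp (ln (real CARD('a) + 1) * real n)"
    by (metis add.commute add_pos_nonneg exp_ln exp_of_nat_mult mult.commute of_nat_0_le_iff zero_less_one)
  also have "\<dots> \<le> exp (\<kappa> * max r 0)"
  proof -
    have "real n \<le> max r 0 / Lmin"
    proof (cases "r \<ge> 0")
      case True
      then have "real n = \<lfloor>r / Lmin\<rfloor>"
        by (simp add: n_def)
      with True show ?thesis
        by simp
    next
      case False
      then have "\<lfloor>r / Lmin\<rfloor> < 0"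
        by (simp add: divide_neg_pos)
      then have "n = 0"
        unfolding n_def by linarith
      then show ?thesis
        by simp
    qed
    then have "ln (real CARD('a) + 1) * real n \<le> ln (real CARD('a) + 1) * (max r 0 / Lmin)"
      by (intro mult_left_mono) auto
    then show ?thesis
      by (simp add: \<kappa>_def)
  qed
  finally show "real (card {u. wlen L u \<le> r}) \<le> exp (\<kappa> * max r 0)" .
qed

end

section \<open>Growth rates of the letters\<close>

context geom_rsubst
begin

definition "g m a = ln (real (card (subst_pow \<Theta> m a))) / (lam ^ m * L a)"
definition "gmin m = Min (range (g m))"
definition "gmax m = Max (range (g m))"

lemma gmin_le [simp]: "gmin m \<le> g m a" and g_le_gmax [simp]: "g m a \<le> gmax m"
  by (auto simp: gmin_def gmax_def)

lemma ln_card_pow: "ln (real (card (subst_pow \<Theta> m a))) = lam ^ m * (L a * g m a)"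
  by (simp add: g_def)

lemma ln_card_subst_word_pow:
  "ln (real (card (subst_word (subst_pow \<Theta> m) u))) = lam ^ m * sum_list (map (\<lambda>b. L b * g m b) u)"
proof (induction u)
  case (Cons a u)
  have "card (subst_word (subst_pow \<Theta> m) u) > 0"
    by (simp add: card_gt_0_iff finite_subst_word subst_word_nonempty)
  moreover have "card (subst_word (subst_pow \<Theta> m) (a # u))
      = card (subst_pow \<Theta> m a) * card (subst_word (subst_pow \<Theta> m) u)"
    by (simp add: card_subst_word_pow)
  ultimately show ?case
    using Cons by (simp add: ln_mult ln_card_pow ring_distribs)
qed simp

text \<open>The images of the single word \<open>w\<close> already form a subset of level
  \<open>k + m\<close>. The weights \<open>L b\<close> along \<open>w\<close> add up to
  \<open>lam ^ k * L a\<close>, so this compares \<open>g (k + m) a\<close> with a weighted average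
  of the \<open>g m b\<close>.\<close>

lemma g_average_le:
  assumes "w \<in> subst_pow \<Theta> k a"
  shows "sum_list (map (\<lambda>b. L b * g m b) w) \<le> lam ^ k * L a * g (k + m) a"
proof -
  have "subst_word (subst_pow \<Theta> m) w \<subseteq> subst_pow \<Theta> (k + m) a"
    using assms by (auto simp: subst_pow_add)
  then have "card (subst_word (subst_pow \<Theta> m) w) \<le> card (subst_pow \<Theta> (k + m) a)"
    by (simp add: card_mono)
  moreover have "card (subst_word (subst_pow \<Theta> m) w) > 0"
    by (simp add: card_gt_0_iff finite_subst_word subst_word_nonempty)
  ultimately have "lam ^ m * sum_list (map (\<lambda>b. L b * g m b) w) \<le> lam ^ (k + m) * (L a * g (k + m) a)"
    unfolding ln_card_subst_word_pow[symmetric] ln_card_pow[symmetric] by simp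
  also have "\<dots> = lam ^ m * (lam ^ k * L a * g (k + m) a)"
    by (simp add: power_add)
  finally show ?thesis
    by simp
qed

lemma sum_list_weighted_ge:
  assumes "\<And>b. c \<le> h b"
  shows "c * wlen L w \<le> sum_list (map (\<lambda>b. L b * h b) w)"
proof (induction w)
  case (Cons a w)
  have "c * L a \<le> L a * h a"
    using mult_left_mono[OF assms[of a], of "L a"] by (simp add: mult.commute[of c])
  from add_mono[OF this Cons] show ?case
    by (simp add: ring_distribs)
qed simp

lemma sum_list_weighted_le:
  assumes "\<And>b. h b \<le> c"
  shows "sum_list (map (\<lambda>b. L b * h b) w) \<le> c * wlen L w"
proof (induction w)
  case (Cons a w)
  have "L a * h a \<le> c * L a"
    using mult_left_mono[OF assms[of a], of "L a"] by (simp add: mult.commute[of c])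
  from add_mono[OF this Cons] show ?case
    by (simp add: ring_distribs)
qed simp

lemma g_add_ge_gmin: "gmin m \<le> g (k + m) a"
proof -
  obtain w where w: "w \<in> subst_pow \<Theta> k a"
    using pow_nonempty by blast
  have "gmin m * (lam ^ k * L a) \<le> g (k + m) a * (lam ^ k * L a)"
    using order_trans[OF sum_list_weighted_ge[of "gmin m" "g m" w] g_average_le[OF w, of m]]
    by (simp add: wlen_subst_pow[OF w] mult.commute)
  then show ?thesis
    by (rule mult_right_le_imp_le) simp
qed

lemma gmin_mono: "incseq gmin"
proof (rule incseq_SucI)
  fix m
  show "gmin m \<le> gmin (Suc m)"
    using g_add_ge_gmin[of m 1] by (subst (2) gmin_def) simp
qed

lemma g_nonneg: "0 \<le> g m a"
  unfolding g_def using card_pow_pos[of m a]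
  by (intro divide_nonneg_pos ln_ge_zero) (auto simp: Suc_le_eq simp del: card_pow_pos)

lemma gmax_nonneg: "0 \<le> gmax m"
  using g_nonneg[of m] g_le_gmax[of m] order_trans by blast

text \<open>The a priori bound that makes the increasing sequence \<open>gmin\<close>
  converge.\<close>

lemma g_le_\<kappa>: "g m a \<le> \<kappa>"
proof -
  have pos: "lam ^ m * L a > 0"
    by simp
  have "subst_pow \<Theta> m a \<subseteq> {u. wlen L u \<le> lam ^ m * L a}"
    using wlen_subst_pow by auto
  then have "real (card (subst_pow \<Theta> m a)) \<le> real (card {u. wlen L u \<le> lam ^ m * L a})"
    by (simp add: card_mono words_bounded_wlen(1))
  also have "\<dots> \<le> exp (\<kappa> * (lam ^ m * L a))"
    using words_bounded_wlen(2)[of "lam ^ m * L a"] pos by (simp add: max_def)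
  finally have "ln (real (card (subst_pow \<Theta> m a))) \<le> \<kappa> * (lam ^ m * L a)"
    by (metis card_pow_pos ln_exp ln_le_cancel_iff exp_gt_zero of_nat_0_less_iff)
  then show ?thesis
    unfolding g_def using pos by (simp add: pos_divide_le_eq)
qed

text \<open>By primitivity every letter has a descendant word in which the letter realising
  \<^term>\<open>gmax m\<close> carries a weight bounded below; so a gap between \<^term>\<open>gmin\<close> and \<^term>\<open>gmax\<close>
  would force \<^term>\<open>gmin\<close> to grow.\<close>

lemma gmin_gap:
  obtains N c where "c > 0" "\<And>m. c * (gmax m - gmin m) \<le> gmin (N + m) - gmin m"
proof -
  obtain N where N: "\<And>p a. p \<ge> N \<Longrightarrow> \<exists>w \<in> subst_pow \<Theta> p a. set w = UNIV"
    using primitive_imp_full_words[OF rs prim] by blast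
  \<comment> \<open>The least possible share of a single tile in a word of level \<open>N\<close>:
    at least \<open>Lmin\<close> out of at most \<open>lam ^ N * Lmax\<close>.\<close>
  define c where "c = Lmin / (lam ^ N * Lmax)"
  have "c * (gmax m - gmin m) \<le> gmin (N + m) - gmin m" for m
  proof -
    have "gmin m + c * (gmax m - gmin m) \<le> g (N + m) a" for a
    proof -
      obtain w where w: "w \<in> subst_pow \<Theta> N a" "set w = UNIV"
        using N[of N a] by auto
      obtain b where b: "gmax m = g m b"
        unfolding gmax_def by (metis Max_in finite finite_imageI image_iff image_is_empty UNIV_not_empty)
      obtain w1 w2 where w12: "w = w1 @ b # w2"
        using w(2) split_list[of b w] by auto
      \<comment> \<open>Keep the exact rate at one occurrence of \<open>b\<close> and replace every
        other rate by \<open>gmin m\<close>.\<close>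
      have "gmin m * wlen L w + L b * (gmax m - gmin m)
          = gmin m * wlen L w1 + (L b * g m b + gmin m * wlen L w2)"
        unfolding w12 b by (simp add: algebra_simps)
      also have "\<dots> \<le> sum_list (map (\<lambda>b. L b * g m b) w)"
        using sum_list_weighted_ge[of "gmin m" "g m"] unfolding w12 by (simp add: add_mono)
      also have "\<dots> \<le> lam ^ N * L a * g (N + m) a"
        by (rule g_average_le[OF w(1)])
      finally have *: "gmin m * (lam ^ N * L a) + L b * (gmax m - gmin m) \<le> lam ^ N * L a * g (N + m) a"
        by (simp add: wlen_subst_pow[OF w(1)])
      have "c * (lam ^ N * L a) \<le> c * (lam ^ N * Lmax)"
        by (intro mult_left_mono) (auto simp: c_def)
      also have "\<dots> = Lmin"
        by (simp add: c_def)
      also have "\<dots> \<le> L b"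
        by simp
      finally have "c * (lam ^ N * L a) * (gmax m - gmin m) \<le> L b * (gmax m - gmin m)"
        using order_trans[OF gmin_le g_le_gmax] by (intro mult_right_mono) auto
      with * have "(lam ^ N * L a) * (gmin m + c * (gmax m - gmin m)) \<le> (lam ^ N * L a) * g (N + m) a"
        by (simp add: algebra_simps)
      then show ?thesis
        by simp
    qed
    then have "gmin m + c * (gmax m - gmin m) \<le> gmin (N + m)"
      unfolding gmin_def[of "N + m"] by simp
    then show ?thesis
      by simp
  qed
  moreover have "c > 0"
    by (simp add: c_def)
  ultimately show thesis
    using that by blast
qed

text \<open>\<open>gmin\<close> converges, so its increments over \<open>N\<close> levels tend to 0;
  by \<open>gmin_gap\<close> these control \<open>gmax m - gmin m\<close>, and both envelopes share
  the limit.\<close>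

lemma growth_rate:
  obtains h where "\<And>a. (\<lambda>m. g m a) \<longlonglongrightarrow> h" "gmax \<longlonglongrightarrow> h"
proof -
  have "gmin m \<le> \<kappa>" for m
    using order_trans[OF gmin_le g_le_\<kappa>] by blast
  then obtain h where h: "gmin \<longlonglongrightarrow> h"
    using incseq_convergent[OF gmin_mono] by blast
  obtain N c where c: "c > 0" "\<And>m. c * (gmax m - gmin m) \<le> gmin (N + m) - gmin m"
    using gmin_gap by blast
  have "(\<lambda>m. gmin m + (gmin (m + N) - gmin m) / c) \<longlonglongrightarrow> h + (h - h) / c"
    by (intro tendsto_intros h LIMSEQ_ignore_initial_segment) (use c in auto)
  then have up: "(\<lambda>m. gmin m + (gmin (m + N) - gmin m) / c) \<longlonglongrightarrow> h"
    by simp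
  have le: "gmax m \<le> gmin m + (gmin (m + N) - gmin m) / c" for m
    using c(2)[of m] c(1) by (simp add: field_simps add.commute)
  have G: "gmax \<longlonglongrightarrow> h"
    by (rule tendsto_sandwich[OF _ _ h up])
      (auto intro!: always_eventually le order_trans[OF gmin_le g_le_gmax])
  have "(\<lambda>m. g m a) \<longlonglongrightarrow> h" for a
    by (rule tendsto_sandwich[OF _ _ h G]) (auto intro!: always_eventually)
  with G that show thesis
    by blast
qed

end

section \<open>Topology of the subshift and of the suspension domain\<close>

text \<open>The central cylinders of radius \<open>k\<close> form a base of the product topology, so
  openness is tested with them throughout.\<close>

definition agree :: "nat \<Rightarrow> (int \<Rightarrow> 'a) \<Rightarrow> (int \<Rightarrow> 'a) \<Rightarrow> bool" where
  "agree k x y \<longleftrightarrow> (\<forall>i. \<bar>i\<bar> \<le> int k \<longrightarrow> x i = y i)"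

lemma agree_refl [simp]: "agree k x x"
  by (simp add: agree_def)

lemma agree_trans: "agree k x y \<Longrightarrow> agree k y z \<Longrightarrow> agree k x z"
  by (simp add: agree_def)

lemma agree_mono: "agree k x y \<Longrightarrow> j \<le> k \<Longrightarrow> agree j x y"
  by (auto simp: agree_def)

abbreviation fullshift_top :: "(int \<Rightarrow> 'a) topology" where
  "fullshift_top \<equiv> product_topology (\<lambda>_. discrete_topology UNIV) UNIV"

lemma openin_fullshift_top:
  "openin fullshift_top W \<longleftrightarrow> (\<forall>x\<in>W. \<exists>k. \<forall>y. agree k x y \<longrightarrow> y \<in> W)"
proof
  assume W: "openin fullshift_top W"
  show "\<forall>x\<in>W. \<exists>k. \<forall>y. agree k x y \<longrightarrow> y \<in> W"
  proof
    fix x assume "x \<in> W"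
    then obtain U where U: "finite {i. U i \<noteq> UNIV}" "\<And>i. x i \<in> U i" "\<And>y. (\<And>i. y i \<in> U i) \<Longrightarrow> y \<in> W"
      using W by (fastforce simp: openin_product_topology_alt PiE_UNIV_domain)
    \<comment> \<open>The sum bounds the absolute value of each of the finitely many constrained
      coordinates.\<close>
    define k where "k = nat (\<Sum>i\<in>{i. U i \<noteq> UNIV}. \<bar>i\<bar>)"
    have "\<bar>i\<bar> \<le> int k" if "U i \<noteq> UNIV" for i
      unfolding k_def using member_le_sum[of i "{i. U i \<noteq> UNIV}" abs] U(1) that by simp
    then have "y \<in> W" if "agree k x y" for y
      using that U(2) by (intro U(3)) (metis UNIV_I agree_def)
    then show "\<exists>k. \<forall>y. agree k x y \<longrightarrow> y \<in> W"
      by blast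
  qed
next
  assume W: "\<forall>x\<in>W. \<exists>k. \<forall>y. agree k x y \<longrightarrow> y \<in> W"
  show "openin fullshift_top W"
    unfolding openin_product_topology_alt
  proof
    fix x assume "x \<in> W"
    then obtain k where k: "\<And>y. agree k x y \<Longrightarrow> y \<in> W"
      using W by blast
    define U where "U i = (if \<bar>i\<bar> \<le> int k then {x i} else UNIV)" for i
    have "{i \<in> UNIV. U i \<noteq> topspace (discrete_topology UNIV)} \<subseteq> {- int k..int k}"
      by (auto simp: U_def split: if_splits)
    then have "finite {i \<in> UNIV. U i \<noteq> topspace (discrete_topology UNIV)}"
      by (rule finite_subset) simp
    moreover have "x \<in> Pi\<^sub>E UNIV U"
      by (auto simp: U_def PiE_UNIV_domain)
    moreover have "Pi\<^sub>E UNIV U \<subseteq> W"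
    proof
      fix y assume "y \<in> Pi\<^sub>E UNIV U"
      then have y: "y i \<in> U i" for i
        by auto
      have "agree k x y"
        unfolding agree_def using y by (auto simp: U_def split: if_splits) (metis singletonD)
      then show "y \<in> W"
        by (rule k)
    qed
    ultimately show "\<exists>U. finite {i \<in> UNIV. U i \<noteq> topspace (discrete_topology UNIV)} \<and>
        (\<forall>i\<in>UNIV. openin (discrete_topology UNIV) (U i)) \<and> x \<in> Pi\<^sub>E UNIV U \<and> Pi\<^sub>E UNIV U \<subseteq> W"
      by (intro exI[of _ U]) simp
  qed
qed

lemma compact_fullshift_top: "compact_space (fullshift_top :: (int \<Rightarrow> 'a::finite) topology)"
  by (simp add: compact_space_product_topology compact_space_discrete_topology)

lemma topspace_X_top [simp]: "topspace (X_top \<Theta>) = subshift \<Theta>"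
  by (simp add: X_top_def)

lemma openin_X_top:
  "openin (X_top \<Theta>) W \<longleftrightarrow>
    W \<subseteq> subshift \<Theta> \<and> (\<forall>x\<in>W. \<exists>k. \<forall>y\<in>subshift \<Theta>. agree k x y \<longrightarrow> y \<in> W)"
proof
  assume "openin (X_top \<Theta>) W"
  then obtain T where T: "openin fullshift_top T" "W = T \<inter> subshift \<Theta>"
    unfolding X_top_def openin_subtopology by blast
  then show "W \<subseteq> subshift \<Theta> \<and> (\<forall>x\<in>W. \<exists>k. \<forall>y\<in>subshift \<Theta>. agree k x y \<longrightarrow> y \<in> W)"
    unfolding openin_fullshift_top by blast
next
  assume W: "W \<subseteq> subshift \<Theta> \<and> (\<forall>x\<in>W. \<exists>k. \<forall>y\<in>subshift \<Theta>. agree k x y \<longrightarrow> y \<in> W)"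
  \<comment> \<open>The union of all full-shift cylinders around points of \<open>W\<close> that
    meet the subshift only inside \<open>W\<close>.\<close>
  define T where "T = {y. \<exists>k. \<exists>x\<in>W. agree k x y \<and> (\<forall>z\<in>subshift \<Theta>. agree k x z \<longrightarrow> z \<in> W)}"
  have "openin fullshift_top T"
    unfolding openin_fullshift_top T_def using agree_trans by blast
  moreover have "W = T \<inter> subshift \<Theta>"
    unfolding T_def using W agree_refl by blast
  ultimately show "openin (X_top \<Theta>) W"
    unfolding X_top_def openin_subtopology by blast
qed

lemma openin_X_top_times_real:
  "openin (prod_topology (X_top \<Theta>) euclideanreal) W \<longleftrightarrow> W \<subseteq> subshift \<Theta> \<times> UNIV \<and>
    (\<forall>x s. (x, s) \<in> W \<longrightarrow> (\<exists>k. \<exists>\<delta>>0. \<forall>y\<in>subshift \<Theta>. \<forall>t. agree k x y \<longrightarrow> \<bar>t - s\<bar> < \<delta> \<longrightarrow> (y, t) \<in> W))"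
    (is "?L \<longleftrightarrow> ?R")
proof
  assume W: ?L
  have "W \<subseteq> subshift \<Theta> \<times> UNIV"
    using openin_subset[OF W] by simp
  moreover have "\<exists>k. \<exists>\<delta>>0. \<forall>y\<in>subshift \<Theta>. \<forall>t. agree k x y \<longrightarrow> \<bar>t - s\<bar> < \<delta> \<longrightarrow> (y, t) \<in> W"
    if xs: "(x, s) \<in> W" for x s
  proof -
    obtain U V where UV: "openin (X_top \<Theta>) U" "open V" "x \<in> U" "s \<in> V" "U \<times> V \<subseteq> W"
      using W xs unfolding openin_prod_topology_alt open_openin[symmetric] by meson
    obtain k where k: "\<And>y. y \<in> subshift \<Theta> \<Longrightarrow> agree k x y \<Longrightarrow> y \<in> U"
      using UV(1,3) unfolding openin_X_top by blast
    obtain \<delta> where \<delta>: "\<delta> > 0" "\<And>t. \<bar>t - s\<bar> < \<delta> \<Longrightarrow> t \<in> V"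
      using UV(2,4) unfolding open_dist dist_real_def by blast
    show ?thesis
      using k \<delta> UV(5) by (intro exI[of _ k] exI[of _ \<delta>]) auto
  qed
  ultimately show ?R
    by blast
next
  assume W: ?R
  show ?L
    unfolding openin_prod_topology_alt
  proof (intro allI impI)
    fix x s assume xs: "(x, s) \<in> W"
    then have x: "x \<in> subshift \<Theta>"
      using W by blast
    obtain k \<delta> where k: "\<delta> > 0" "\<And>y t. y \<in> subshift \<Theta> \<Longrightarrow> agree k x y \<Longrightarrow> \<bar>t - s\<bar> < \<delta> \<Longrightarrow> (y, t) \<in> W"
      using W xs by blast
    have "openin (X_top \<Theta>) {y \<in> subshift \<Theta>. agree k x y}"
      unfolding openin_X_top using agree_trans by blast
    moreover have "openin euclideanreal (ball s \<delta>)"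
      by (simp flip: open_openin)
    moreover have "{y \<in> subshift \<Theta>. agree k x y} \<times> ball s \<delta> \<subseteq> W"
      using k(2) by (auto simp: dist_real_def abs_minus_commute)
    ultimately show "\<exists>U V. openin (X_top \<Theta>) U \<and> openin euclideanreal V \<and> x \<in> U \<and> s \<in> V \<and> U \<times> V \<subseteq> W"
      using x k(1) by (intro exI[of _ "{y \<in> subshift \<Theta>. agree k x y}"] exI[of _ "ball s \<delta>"]) auto
  qed
qed

lemma openin_susp_domain_top:
  "openin (susp_domain_top \<Theta> L) W \<longleftrightarrow> W \<subseteq> susp_domain \<Theta> L \<and>
    (\<forall>x s. (x, s) \<in> W \<longrightarrow>
      (\<exists>k. \<exists>\<delta>>0. \<forall>y t. (y, t) \<in> susp_domain \<Theta> L \<longrightarrow> agree k x y \<longrightarrow> \<bar>t - s\<bar> < \<delta> \<longrightarrow> (y, t) \<in> W))"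
    (is "?L \<longleftrightarrow> ?R")
proof
  assume ?L
  then obtain T where T: "openin (prod_topology (X_top \<Theta>) euclideanreal) T" "W = T \<inter> susp_domain \<Theta> L"
    unfolding susp_domain_top_def openin_subtopology by blast
  have dom: "y \<in> subshift \<Theta>" if "(y, t) \<in> susp_domain \<Theta> L" for y t
    using that by (simp add: susp_domain_def)
  have "\<exists>k. \<exists>\<delta>>0. \<forall>y t. (y, t) \<in> susp_domain \<Theta> L \<longrightarrow> agree k x y \<longrightarrow> \<bar>t - s\<bar> < \<delta> \<longrightarrow> (y, t) \<in> W"
    if "(x, s) \<in> W" for x s
  proof -
    from that have "(x, s) \<in> T"
      by (simp add: T(2))
    with T(1) obtain k \<delta> where "\<delta> > 0" "\<forall>y\<in>subshift \<Theta>. \<forall>t. agree k x y \<longrightarrow> \<bar>t - s\<bar> < \<delta> \<longrightarrow> (y, t) \<in> T"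
      unfolding openin_X_top_times_real by blast
    then show ?thesis
      using T(2) dom by blast
  qed
  with T(2) show ?R
    by blast
next
  assume W: ?R
  \<comment> \<open>Again the union of basic neighbourhoods of points of \<open>W\<close> that meet
    the suspension domain only inside \<open>W\<close>.\<close>
  define T where "T = {(y, t). y \<in> subshift \<Theta> \<and> (\<exists>k x s \<delta>. agree k x y \<and> \<bar>t - s\<bar> < \<delta> \<and> (x, s) \<in> W \<and>
    (\<forall>y t. (y, t) \<in> susp_domain \<Theta> L \<longrightarrow> agree k x y \<longrightarrow> \<bar>t - s\<bar> < \<delta> \<longrightarrow> (y, t) \<in> W))}"
  have "openin (prod_topology (X_top \<Theta>) euclideanreal) T"
    unfolding openin_X_top_times_real
  proof (intro conjI allI impI)
    show "T \<subseteq> subshift \<Theta> \<times> UNIV"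
      by (auto simp: T_def)
    fix y t assume "(y, t) \<in> T"
    then obtain k x s \<delta> where *: "y \<in> subshift \<Theta>" "agree k x y" "\<bar>t - s\<bar> < \<delta>" "(x, s) \<in> W"
        "\<forall>y t. (y, t) \<in> susp_domain \<Theta> L \<longrightarrow> agree k x y \<longrightarrow> \<bar>t - s\<bar> < \<delta> \<longrightarrow> (y, t) \<in> W"
      unfolding T_def by blast
    have "(z, u) \<in> T" if "z \<in> subshift \<Theta>" "agree k y z" "\<bar>u - t\<bar> < \<delta> - \<bar>t - s\<bar>" for z u
    proof -
      have "\<bar>u - s\<bar> < \<delta>"
        using that(3) by linarith
      then show ?thesis
        unfolding T_def using * that(1) agree_trans[OF *(2) that(2)] by blast
    qed
    then show "\<exists>k. \<exists>\<delta>>0. \<forall>z\<in>subshift \<Theta>. \<forall>u. agree k y z \<longrightarrow> \<bar>u - t\<bar> < \<delta> \<longrightarrow> (z, u) \<in> T"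
      using *(3) by (intro exI[of _ k] exI[of _ "\<delta> - \<bar>t - s\<bar>"]) auto
  qed
  moreover have "W = T \<inter> susp_domain \<Theta> L"
  proof (intro equalityI subsetI)
    fix p assume p: "p \<in> W"
    obtain x s where xs: "p = (x, s)"
      by (cases p)
    obtain k \<delta> where "\<delta> > 0"
        "\<forall>y t. (y, t) \<in> susp_domain \<Theta> L \<longrightarrow> agree k x y \<longrightarrow> \<bar>t - s\<bar> < \<delta> \<longrightarrow> (y, t) \<in> W"
      using W p xs by blast
    moreover have "p \<in> susp_domain \<Theta> L" "x \<in> subshift \<Theta>" "\<bar>s - s\<bar> < \<delta>"
      using W p xs \<open>\<delta> > 0\<close> by (auto simp: susp_domain_def)
    ultimately show "p \<in> T \<inter> susp_domain \<Theta> L"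
      using p xs agree_refl[of k x] unfolding T_def by blast
  qed (auto simp: T_def)
  ultimately show ?L
    unfolding susp_domain_top_def openin_subtopology by blast
qed

section \<open>Legal words and points of the subshift\<close>

lemma map_upto_shift: "map (\<lambda>i. x (i + n)) [i..j] = map x [i + n..j + n]"
  by (rule nth_equalityI) (auto simp: nth_upto algebra_simps)

lemma language_sublist: "u1 @ w @ u2 \<in> language \<Theta> \<Longrightarrow> w \<noteq> [] \<Longrightarrow> w \<in> language \<Theta>"
proof -
  assume "u1 @ w @ u2 \<in> language \<Theta>" and w: "w \<noteq> []"
  then obtain n a v v1 v2 where n: "n \<ge> 1" "v \<in> subst_pow \<Theta> n a" "v = v1 @ (u1 @ w @ u2) @ v2"
    unfolding language_def by blast
  then have "v = (v1 @ u1) @ w @ (u2 @ v2)"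
    by simp
  with n w show "w \<in> language \<Theta>"
    unfolding language_def by blast
qed

lemma map_upto_split:
  assumes "i \<le> i'" "i' \<le> j'" "j' \<le> j"
  shows "map x [i..j] = map x [i..i' - 1] @ map x [i'..j'] @ map x [j' + 1..j]"
  using assms by (simp add: upto_split1[of i i' j] upto_split2[of i' j' j] flip: map_append)

text \<open>Compactness of the full shift turns legal words with arbitrarily long legal extensions
  into points of the subshift.\<close>

lemma subshift_point_exists:
  fixes \<Theta> :: "('a::finite) rsubst"
  assumes ext: "\<And>K. \<exists>u1 u2. length u1 = K \<and> length u2 = K \<and> u1 @ v @ u2 \<in> language \<Theta>"
  shows "\<exists>x\<in>subshift \<Theta>. map x [0..int (length v) - 1] = v"
proof -
  \<comment> \<open>Points that show \<open>v\<close> at the origin and are legal inside the window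
    from \<open>-K\<close> to \<open>K\<close>. These sets are closed and decrease with
    \<open>K\<close>.\<close>
  define C where "C K = {x. map x [0..int (length v) - 1] = v \<and>
    (\<forall>i j. - int K \<le> i \<longrightarrow> i \<le> j \<longrightarrow> j \<le> int K \<longrightarrow> map x [i..j] \<in> language \<Theta>)}" for K
  have map_agree: "map x [i..j] = map y [i..j]" if "agree k x y" "\<bar>i\<bar> \<le> int k" "\<bar>j\<bar> \<le> int k" for x y :: "int \<Rightarrow> 'a" and i j k
    using that by (auto simp: agree_def)
  have "\<Inter>(range C) \<noteq> {}"
  proof (rule compact_space_imp_nest[OF compact_fullshift_top])
    fix K
    show "closedin fullshift_top (C K)"
      unfolding closedin_def openin_fullshift_top
    proof (intro conjI ballI)
      fix x assume x: "x \<in> topspace fullshift_top - C K"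
      have "y \<in> topspace fullshift_top - C K" if a: "agree (K + length v) x y" for y
      proof -
        have "map x [0..int (length v) - 1] = map y [0..int (length v) - 1]"
          using a by (auto simp: agree_def)
        moreover have "map x [i..j] = map y [i..j]" if "- int K \<le> i" "i \<le> j" "j \<le> int K" for i j
          by (rule map_agree[OF a]) (use that in auto)
        ultimately have "y \<in> C K \<Longrightarrow> x \<in> C K"
          unfolding C_def mem_Collect_eq by metis
        with x show ?thesis
          by auto
      qed
      then show "\<exists>k. \<forall>y. agree k x y \<longrightarrow> y \<in> topspace fullshift_top - C K"
        by blast
    qed simp
    show "C K \<noteq> {}"
    proof -
      \<comment> \<open>The extended word then covers the whole window; the \<open>Suc\<close>
        absorbs the \<open>- 1\<close> at its right end. Values of \<open>x\<close> beyond the word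
        do not affect membership in \<open>C K\<close>.\<close>
      define M where "M = Suc (K + length v)"
      obtain u1 u2 where u: "length u1 = M" "length u2 = M" "u1 @ v @ u2 \<in> language \<Theta>"
        using ext by blast
      let ?w = "u1 @ v @ u2"
      define x where "x i = ?w ! nat (i + int M)" for i
      have w: "map x [- int M..int (length v + M) - 1] = ?w"
        by (rule nth_equalityI) (auto simp: u x_def nth_upto)
      have sub: "map x [i..j] \<in> language \<Theta>" if "- int M \<le> i" "i \<le> j" "j \<le> int (length v + M) - 1" for i j
      proof (rule language_sublist)
        show "map x [- int M..i - 1] @ map x [i..j] @ map x [j + 1..int (length v + M) - 1] \<in> language \<Theta>"
          using u(3) w map_upto_split[OF that, of x] by simp
      qed (use that in auto)
      have "map x [0..int (length v) - 1] = v"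
        by (rule nth_equalityI) (auto simp: u x_def nth_upto nth_append nat_add_distrib)
      with sub have "x \<in> C K"
        by (auto simp: C_def M_def)
      then show ?thesis
        by blast
    qed
    show "antimono C"
      by (auto simp: antimono_def C_def)
  qed
  then obtain x where x: "\<And>K. x \<in> C K"
    by blast
  have "map x [i..j] \<in> language \<Theta>" if "i \<le> j" for i j
    using x[of "nat (\<bar>i\<bar> + \<bar>j\<bar>)"] that by (auto simp: C_def)
  with x[of 0] show ?thesis
    by (auto simp: C_def subshift_def)
qed

text \<open>A point outside the subshift shows an illegal word on a finite window, so its cylinder
  over that window avoids the subshift.\<close>

lemma compact_X_top: "compact_space (X_top (\<Theta> :: ('a::finite) rsubst))"
proof -
  have "closedin fullshift_top (subshift \<Theta>)"
    unfolding closedin_def openin_fullshift_top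
  proof (intro conjI ballI)
    fix x assume "x \<in> topspace fullshift_top - subshift \<Theta>"
    then obtain i j where ij: "i \<le> j" "map x [i..j] \<notin> language \<Theta>"
      by (auto simp: subshift_def)
    have "y \<notin> subshift \<Theta>" if "agree (nat (\<bar>i\<bar> + \<bar>j\<bar>)) x y" for y
    proof -
      have "map x [i..j] = map y [i..j]"
        using that by (auto simp: agree_def)
      with ij show ?thesis
        by (auto simp: subshift_def)
    qed
    then show "\<exists>k. \<forall>y. agree k x y \<longrightarrow> y \<in> topspace fullshift_top - subshift \<Theta>"
      by auto
  qed simp
  then have "compactin fullshift_top (subshift \<Theta>)"
    by (rule closedin_compact_space[OF compact_fullshift_top])
  then show ?thesis
    by (simp add: X_top_def compact_space_subtopology)
qed

section \<open>The suspension flow\<close>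

definition sh :: "int \<Rightarrow> (int \<Rightarrow> 'a) \<Rightarrow> int \<Rightarrow> 'a" where
  "sh n x = (\<lambda>i. x (i + n))"

lemma sh_apply [simp]: "sh n x i = x (i + n)"
  by (simp add: sh_def)

lemma sh_sh [simp]: "sh m (sh n x) = sh (m + n) x"
  by (auto simp: sh_def add.assoc)

lemma sh_0 [simp]: "sh 0 x = x"
  by (auto simp: sh_def)

lemma shift_eq_sh: "shift x = sh 1 x"
  by (auto simp: sh_def shift_def)

lemma sh_in_subshift [simp]: "x \<in> subshift \<Theta> \<Longrightarrow> sh n x \<in> subshift \<Theta>"
  by (simp add: subshift_def sh_def map_upto_shift)

lemma agree_sh:
  assumes "agree (k + nat \<bar>n\<bar>) x y"
  shows "agree k (sh n x) (sh n y)"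
  using assms by (auto simp: agree_def)

lemma roof_sum_0 [simp]: "roof_sum L 0 x = 0"
  by (simp add: roof_sum_def)

text \<open>\<open>roof_sum L n x\<close> is the position of the left end of tile \<open>n\<close>
  when tile 0 starts at position 0; tiles with negative index lie to the left.\<close>

lemma roof_sum_Suc: "roof_sum L (n + 1) x = roof_sum L n x + L (x n)"
proof (cases "n \<ge> 0")
  case True
  then have "{0..<n + 1} = insert n {0..<n}"
    by auto
  with True show ?thesis
    by (simp add: roof_sum_def)
next
  case False
  then have "{n..<0} = insert n {n + 1..<0}"
    by auto
  with False show ?thesis
    by (cases "n = -1") (auto simp: roof_sum_def)
qed

text \<open>The cocycle identity. Both indices may be negative, hence the two-sided
  induction.\<close>

lemma roof_sum_add: "roof_sum L (m + n) x = roof_sum L m x + roof_sum L n (sh m x)"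
proof (induction n rule: int_induct[where k = 0])
  case (step1 i)
  have "roof_sum L (m + (i + 1)) x = roof_sum L (m + i) x + L (x (m + i))"
    using roof_sum_Suc[of L "m + i" x] by (simp add: add.assoc)
  moreover have "roof_sum L (i + 1) (sh m x) = roof_sum L i (sh m x) + L (x (m + i))"
    using roof_sum_Suc[of L i "sh m x"] by (simp add: add.commute)
  ultimately show ?case
    using step1 by linarith
next
  case (step2 i)
  have "roof_sum L (m + (i - 1) + 1) x = roof_sum L (m + (i - 1)) x + L (x (m + (i - 1)))"
    by (rule roof_sum_Suc)
  moreover have "roof_sum L (i - 1 + 1) (sh m x) = roof_sum L (i - 1) (sh m x) + L (sh m x (i - 1))"
    by (rule roof_sum_Suc)
  moreover have "m + (i - 1) + 1 = m + i" "i - 1 + 1 = i" "sh m x (i - 1) = x (m + (i - 1))"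
    by (simp_all add: algebra_simps)
  ultimately show ?case
    using step2 by (simp only:)
qed simp

lemma roof_sum_agree:
  assumes "agree k x y" "\<bar>n\<bar> \<le> int k"
  shows "roof_sum L n x = roof_sum L n y"
  using assms unfolding roof_sum_def agree_def
  by (auto intro!: sum.cong arg_cong[where f = L])

context geom_rsubst
begin

section \<open>Tile positions and the flow in line coordinates\<close>

abbreviation "roof \<equiv> roof_sum L"
abbreviation "X \<equiv> subshift \<Theta>"

lemma roof_diff_ge: "m \<le> n \<Longrightarrow> Lmin * real_of_int (n - m) \<le> roof n x - roof m x"
proof (induction n rule: int_ge_induct)
  case (step i)
  have "Lmin \<le> L (x i)"
    by simp
  moreover have "Lmin * real_of_int (i + 1 - m) = Lmin * real_of_int (i - m) + Lmin"
    by (simp add: algebra_simps)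
  ultimately show ?case
    unfolding roof_sum_Suc using step.IH by linarith
qed simp

lemma roof_mono: "m \<le> n \<Longrightarrow> roof m x \<le> roof n x"
  using order_trans[OF mult_nonneg_nonneg roof_diff_ge[of m n x]] by simp

lemma abs_roof_diff_ge: "Lmin * \<bar>real_of_int (n - m)\<bar> \<le> \<bar>roof n x - roof m x\<bar>"
proof (cases "m \<le> n")
  case True
  then show ?thesis
    using roof_diff_ge[of m n x] by auto
next
  case False
  then show ?thesis
    using roof_diff_ge[of n m x] by (auto simp: abs_minus_commute)
qed

text \<open>Tiles have length at least \<open>Lmin\<close>, so tile \<open>- N\<close> starts at or
  before \<open>s\<close> and tile \<open>N + 1\<close> after it; the tile just before the first one
  that starts after \<open>s\<close> contains \<open>s\<close>.\<close>

lemma roof_index_exists: "\<exists>n. roof n x \<le> s \<and> s < roof (n + 1) x"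
proof -
  define N where "N = \<lceil>\<bar>s\<bar> / Lmin\<rceil> + 1"
  have "\<bar>s\<bar> / Lmin \<le> real_of_int N"
    unfolding N_def by linarith
  moreover have "\<bar>s\<bar> / Lmin \<ge> 0"
    by simp
  then have "N > 0"
    unfolding N_def by linarith
  ultimately have "\<bar>s\<bar> / Lmin \<le> real_of_int N" and "N > 0"
    by auto
  then have N: "\<bar>s\<bar> \<le> Lmin * real_of_int N"
    by (simp add: field_simps)
  have low: "roof (- N) x \<le> s"
    using roof_diff_ge[of "- N" 0 x] N \<open>N > 0\<close> by (simp add: abs_le_iff)
  have "\<bar>s\<bar> < Lmin * real_of_int (N + 1)"
    using N Lmin_pos by (simp add: algebra_simps del: Lmin_pos)
  then have "s < roof (- N + int (nat (2 * N + 1))) x"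
    using roof_diff_ge[of 0 "N + 1" x] \<open>N > 0\<close> by (simp add: add.commute)
  then have ex: "\<exists>k. s < roof (- N + int k) x"
    by blast
  define k where "k = (LEAST k. s < roof (- N + int k) x)"
  have k: "s < roof (- N + int k) x"
    unfolding k_def by (rule LeastI_ex[OF ex])
  with low obtain j where j: "k = Suc j"
    by (cases k) auto
  then have "roof (- N + int j) x \<le> s"
    unfolding k_def by (metis lessI not_less_Least not_less)
  with k j show ?thesis
    by (intro exI[of _ "- N + int j"]) (simp add: algebra_simps)
qed

lemma roof_index_unique:
  assumes "roof m x \<le> s" "s < roof (m + 1) x" "roof n x \<le> s" "s < roof (n + 1) x"
  shows "m = n"
proof (rule ccontr)
  assume "m \<noteq> n"
  then consider "m + 1 \<le> n" | "n + 1 \<le> m"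
    by linarith
  then show False
    using assms roof_mono[of "m + 1" n x] roof_mono[of "n + 1" m x] by cases auto
qed

definition idx :: "(int \<Rightarrow> 'a) \<Rightarrow> real \<Rightarrow> int" where
  "idx x s = (THE n. roof n x \<le> s \<and> s < roof (n + 1) x)"

text \<open>\<open>pt x s\<close> is the canonical representative of \<open>T\<^sub>s (x, 0)\<close>, for arbitrary real \<open>s\<close>; it
  trades the boundary identification for the invariance \<open>pt_sh\<close>.\<close>

definition pt :: "(int \<Rightarrow> 'a) \<Rightarrow> real \<Rightarrow> (int \<Rightarrow> 'a) \<times> real" where
  "pt x s = (sh (idx x s) x, s - roof (idx x s) x)"

lemma idx: "roof (idx x s) x \<le> s" "s < roof (idx x s + 1) x"
proof -
  have "\<exists>!n. roof n x \<le> s \<and> s < roof (n + 1) x"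
    using roof_index_exists[of x s] roof_index_unique[of _ x s] by blast
  from theI'[OF this] show "roof (idx x s) x \<le> s" "s < roof (idx x s + 1) x"
    by (auto simp: idx_def)
qed

lemma pt_eqI: "roof n x \<le> s \<Longrightarrow> s < roof (n + 1) x \<Longrightarrow> pt x s = (sh n x, s - roof n x)"
  using roof_index_unique[OF idx[where x = x and s = s], of n] by (simp add: pt_def)

text \<open>Moving the origin to the left end of tile \<open>n\<close> changes every position by
  \<open>roof n x\<close> but not the point of the hull. The identification at the roof is the case
  \<open>n = 1\<close>.\<close>

lemma pt_sh: "pt (sh n x) (s - roof n x) = pt x s"
proof -
  let ?m = "idx x s"
  have 1: "roof (?m - n) (sh n x) = roof ?m x - roof n x"
    using roof_sum_add[of L n "?m - n" x] by simp
  have 2: "roof (?m - n + 1) (sh n x) = roof (?m + 1) x - roof n x"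
    using roof_sum_add[of L n "?m - n + 1" x] by (simp add: algebra_simps)
  have "pt (sh n x) (s - roof n x) = (sh (?m - n) (sh n x), s - roof n x - roof (?m - n) (sh n x))"
    by (rule pt_eqI) (use idx[where x = x and s = s] 1 2 in auto)
  then show ?thesis
    by (simp add: pt_def 1)
qed

lemma pt_base: "0 \<le> s \<Longrightarrow> s < L (x 0) \<Longrightarrow> pt x s = (x, s)"
  using pt_eqI[of 0 x s] roof_sum_Suc[of L 0 x] by simp

lemma pt_L: "pt x (L (x 0)) = (sh 1 x, 0)"
  using pt_sh[of 1 x "L (x 0)"] pt_base[where s = 0 and x = "sh 1 x"] roof_sum_Suc[of L 0 x] by simp

text \<open>Converse of \<open>pt_sh\<close>: equal representatives lie in the same tile at the same
  offset, and the difference of the two tile indices is the shift.\<close>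

lemma pt_eqD:
  assumes "pt x s = pt y t"
  shows "\<exists>p. y = sh p x \<and> t = s - roof p x"
proof (intro exI conjI)
  let ?m = "idx x s" and ?n = "idx y t"
  have eq: "sh ?m x = sh ?n y" "s - roof ?m x = t - roof ?n y"
    using assms by (auto simp: pt_def)
  from arg_cong[OF eq(1), of "sh (- ?n)"] show y: "y = sh (?m - ?n) x"
    by simp
  have "roof ?m x = roof (?m - ?n) x + roof ?n y"
    using roof_sum_add[of L "?m - ?n" ?n x] by (simp flip: y)
  with eq(2) show "t = s - roof (?m - ?n) x"
    by simp
qed

lemma pt_in_reps: "x \<in> X \<Longrightarrow> pt x s \<in> susp_reps \<Theta> L"
  using idx[where x = x and s = s] by (simp add: susp_reps_def pt_def roof_sum_Suc)

lemma reps_eq_pt: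
  assumes "p \<in> susp_reps \<Theta> L"
  obtains x s where "x \<in> X" "0 \<le> s" "s < L (x 0)" "p = pt x s"
proof -
  obtain x s where "p = (x, s)" "x \<in> X" "0 \<le> s" "s < L (x 0)"
    using assms by (auto simp: susp_reps_def)
  with that[of x s] show thesis
    by (simp add: pt_base)
qed

text \<open>The description \<open>THE\<close> in \<open>susp_flow\<close> is resolved by the
  uniqueness of the tile containing position \<open>s + t\<close>.\<close>

lemma susp_flow_eq_pt:
  assumes "x \<in> X"
  shows "susp_flow \<Theta> L t (x, s) = pt x (s + t)"
  unfolding susp_flow_def
proof (rule the_equality)
  show "pt x (s + t) \<in> susp_reps \<Theta> L \<and> (\<exists>n. fst (pt x (s + t)) = (\<lambda>i. fst (x, s) (i + n)) \<and>
      snd (pt x (s + t)) = snd (x, s) + t - roof n (fst (x, s)))"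
    using pt_in_reps[OF assms] by (auto simp: pt_def sh_def)
next
  fix q assume q: "q \<in> susp_reps \<Theta> L \<and> (\<exists>n. fst q = (\<lambda>i. fst (x, s) (i + n)) \<and>
      snd q = snd (x, s) + t - roof n (fst (x, s)))"
  then obtain n where n: "q = (sh n x, s + t - roof n x)"
    by (cases q) (auto simp: sh_def)
  with q have "0 \<le> s + t - roof n x" "s + t - roof n x < L (x n)"
    by (auto simp: susp_reps_def)
  then have "pt x (s + t) = (sh n x, s + t - roof n x)"
    by (intro pt_eqI) (auto simp: roof_sum_Suc)
  with n show "q = pt x (s + t)"
    by simp
qed

abbreviation "T1 \<equiv> susp_flow \<Theta> L 1"

lemma T1_pow_pt:
  assumes "x \<in> X"
  shows "(T1 ^^ i) (pt x s) = pt x (s + real i)"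
proof (induction i)
  case (Suc i)
  let ?s = "s + real i" and ?n = "idx x (s + real i)"
  have "T1 (pt x ?s) = pt (sh ?n x) (?s - roof ?n x + 1)"
    using assms by (simp add: pt_def susp_flow_eq_pt)
  also have "\<dots> = pt x (?s + 1)"
    using pt_sh[of ?n x "?s + 1"] by (simp add: algebra_simps)
  finally show ?case
    using Suc by (simp add: algebra_simps)
qed simp

section \<open>The quotient topology of the hull in line coordinates\<close>

abbreviation "SD \<equiv> susp_domain \<Theta> L"

lemma susp_quot_eq_pt: "(x, s) \<in> SD \<Longrightarrow> susp_quot L (x, s) = pt x s"
  by (auto simp: susp_domain_def susp_quot_def pt_L pt_base shift_eq_sh)

abbreviation "Y \<equiv> Y_top \<Theta> L"

text \<open>\<open>Y_top\<close> is built with \<open>topology\<close>, whose open sets are the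
  intended ones once \<open>istopology\<close> is verified; preimages commute with intersections and
  unions.\<close>

lemma openin_Y_top_quot:
  "openin Y U \<longleftrightarrow> U \<subseteq> susp_reps \<Theta> L \<and> openin (susp_domain_top \<Theta> L) {p \<in> SD. susp_quot L p \<in> U}"
proof -
  let ?P = "\<lambda>U. U \<subseteq> susp_reps \<Theta> L \<and> openin (susp_domain_top \<Theta> L) {p \<in> SD. susp_quot L p \<in> U}"
  have "istopology ?P"
    unfolding istopology_def
  proof (intro conjI allI impI)
    fix A B assume *: "?P A" "?P B"
    then show "A \<inter> B \<subseteq> susp_reps \<Theta> L"
      by blast
    have "{p \<in> SD. susp_quot L p \<in> A \<inter> B} = {p \<in> SD. susp_quot L p \<in> A} \<inter> {p \<in> SD. susp_quot L p \<in> B}"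
      by blast
    with * show "openin (susp_domain_top \<Theta> L) {p \<in> SD. susp_quot L p \<in> A \<inter> B}"
      by (simp add: openin_Int)
  next
    fix \<K> assume *: "\<forall>K\<in>\<K>. ?P K"
    then show "\<Union>\<K> \<subseteq> susp_reps \<Theta> L"
      by blast
    have "{p \<in> SD. susp_quot L p \<in> \<Union>\<K>} = \<Union>((\<lambda>K. {p \<in> SD. susp_quot L p \<in> K}) ` \<K>)"
      by blast
    with * show "openin (susp_domain_top \<Theta> L) {p \<in> SD. susp_quot L p \<in> \<Union>\<K>}"
      by (auto intro!: openin_Union)
  qed
  then show ?thesis
    unfolding Y_top_def by (simp add: topology_inverse')
qed

text \<open>Neighbourhoods in the coordinates of \<open>pt\<close>, with \<open>s\<close> any real
  and not confined to tile 0, so that crossing a tile boundary needs no case distinction.\<close>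

definition locally_in :: "((int \<Rightarrow> 'a) \<times> real) set \<Rightarrow> (int \<Rightarrow> 'a) \<Rightarrow> real \<Rightarrow> bool" where
  "locally_in U x s \<longleftrightarrow> (\<exists>k. \<exists>\<delta>>0. \<forall>y\<in>X. \<forall>t. agree k x y \<longrightarrow> \<bar>t - s\<bar> < \<delta> \<longrightarrow> pt y t \<in> U)"

lemma locally_in_sh:
  assumes "locally_in U (sh n x) (s - roof n x)"
  shows "locally_in U x s"
proof -
  obtain k \<delta> where k: "\<delta> > 0" "\<And>y t. y \<in> X \<Longrightarrow> agree k (sh n x) y \<Longrightarrow> \<bar>t - (s - roof n x)\<bar> < \<delta> \<Longrightarrow> pt y t \<in> U"
    using assms unfolding locally_in_def by blast
  have "pt y t \<in> U" if y: "y \<in> X" "agree (k + nat \<bar>n\<bar>) x y" "\<bar>t - s\<bar> < \<delta>" for y t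
  proof -
    have "roof n x = roof n y"
      by (rule roof_sum_agree[OF y(2)]) simp
    then have "pt (sh n y) (t - roof n y) \<in> U"
      using y by (intro k(2) agree_sh) auto
    then show ?thesis
      by (simp add: pt_sh)
  qed
  with k(1) show ?thesis
    unfolding locally_in_def by blast
qed

text \<open>By \<open>locally_in_sh\<close> only positions inside tile 0 matter for the forward
  direction. In its interior a domain neighbourhood is used directly; its left end requires gluing
  two of them.\<close>

lemma openin_Y_top:
  "openin Y U \<longleftrightarrow> U \<subseteq> susp_reps \<Theta> L \<and> (\<forall>x\<in>X. \<forall>s. pt x s \<in> U \<longrightarrow> locally_in U x s)"
proof
  assume "openin Y U"
  then have U: "U \<subseteq> susp_reps \<Theta> L" and op: "openin (susp_domain_top \<Theta> L) {p \<in> SD. susp_quot L p \<in> U}"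
    by (auto simp: openin_Y_top_quot)
  have nb: "\<exists>k. \<exists>\<delta>>0. \<forall>y t. (y, t) \<in> SD \<longrightarrow> agree k x y \<longrightarrow> \<bar>t - s\<bar> < \<delta> \<longrightarrow> pt y t \<in> U"
    if "(x, s) \<in> SD" "pt x s \<in> U" for x s
  proof -
    have "(x, s) \<in> {p \<in> SD. susp_quot L p \<in> U}"
      using that by (simp add: susp_quot_eq_pt)
    with op obtain k \<delta> where "\<delta> > 0"
        "\<forall>y t. (y, t) \<in> SD \<longrightarrow> agree k x y \<longrightarrow> \<bar>t - s\<bar> < \<delta> \<longrightarrow> (y, t) \<in> {p \<in> SD. susp_quot L p \<in> U}"
      unfolding openin_susp_domain_top by blast
    then show ?thesis
      using susp_quot_eq_pt by (intro exI[of _ k] exI[of _ \<delta>]) auto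
  qed
  have base: "locally_in U x s" if x: "x \<in> X" and s: "0 \<le> s" "s < L (x 0)" and ptU: "pt x s \<in> U" for x s
  proof -
    have "(x, s) \<in> SD"
      using x s by (simp add: susp_domain_def)
    from nb[OF this ptU] obtain k1 \<delta>1 where 1: "\<delta>1 > 0"
        "\<And>y t. (y, t) \<in> SD \<Longrightarrow> agree k1 x y \<Longrightarrow> \<bar>t - s\<bar> < \<delta>1 \<Longrightarrow> pt y t \<in> U"
      by blast
    show ?thesis
    proof (cases "s = 0")
      case False
      define \<delta> where "\<delta> = min \<delta>1 (min s (L (x 0) - s))"
      have "\<delta> > 0"
        using 1 s False by (simp add: \<delta>_def)
      moreover have "pt y t \<in> U" if y: "y \<in> X" "agree k1 x y" "\<bar>t - s\<bar> < \<delta>" for y t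
      proof (rule 1(2)[OF _ y(2)])
        have "x 0 = y 0"
          using y(2) by (simp add: agree_def)
        then show "(y, t) \<in> SD"
          using y(1,3) by (auto simp: susp_domain_def \<delta>_def)
      qed (use y(3) in \<open>simp add: \<delta>_def\<close>)
      ultimately show ?thesis
        unfolding locally_in_def by blast
    next
      case True
      \<comment> \<open>The point \<open>(x, 0)\<close> is also the top of the preceding tile.
        Nearby positions \<open>t \<ge> 0\<close> use the neighbourhood at the bottom of tile 0, and
        \<open>t < 0\<close> the one at the top of tile \<open>-1\<close>.\<close>
      have "(sh (-1) x, L (sh (-1) x 0)) \<in> SD"
        using x by (simp add: susp_domain_def)
      moreover have "pt (sh (-1) x) (L (sh (-1) x 0)) = pt x s"
        using pt_L[of "sh (-1) x"] pt_base[where s = s and x = x, OF s] True by simp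
      ultimately obtain k2 \<delta>2 where 2: "\<delta>2 > 0"
          "\<And>y t. (y, t) \<in> SD \<Longrightarrow> agree k2 (sh (-1) x) y \<Longrightarrow> \<bar>t - L (sh (-1) x 0)\<bar> < \<delta>2 \<Longrightarrow> pt y t \<in> U"
        using nb[of "sh (-1) x" "L (sh (-1) x 0)"] ptU by auto
      define \<delta> where "\<delta> = min (min \<delta>1 \<delta>2) (min (L (x 0)) (L (x (-1))))"
      define k where "k = k1 + k2 + 1"
      have "\<delta> > 0"
        using 1 2 by (simp add: \<delta>_def)
      moreover have "pt y t \<in> U" if y: "y \<in> X" "agree k x y" "\<bar>t - s\<bar> < \<delta>" for y t
      proof (cases "t \<ge> 0")
        case t: True
        have "x 0 = y 0"
          using y(2) by (simp add: agree_def)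
        then have "(y, t) \<in> SD"
          using y(1,3) t True by (auto simp: susp_domain_def \<delta>_def)
        moreover have "agree k1 x y"
          by (rule agree_mono[OF y(2)]) (simp add: k_def)
        ultimately show ?thesis
          by (rule 1(2)) (use y(3) in \<open>simp add: \<delta>_def\<close>)
      next
        case t: False
        have eq: "x (-1) = y (-1)"
          using y(2) by (simp add: agree_def k_def)
        have roof: "roof (-1) y = - L (y (-1))"
          using roof_sum_Suc[of L "-1" y] by simp
        have "(sh (-1) y, t + L (y (-1))) \<in> SD"
          using y(1,3) t True eq by (auto simp: susp_domain_def \<delta>_def)
        moreover have "agree k2 (sh (-1) x) (sh (-1) y)"
          by (rule agree_sh, rule agree_mono[OF y(2)]) (simp add: k_def)
        moreover have "\<bar>t + L (y (-1)) - L (sh (-1) x 0)\<bar> < \<delta>2"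
          using y(3) True eq by (simp add: \<delta>_def)
        ultimately have "pt (sh (-1) y) (t + L (y (-1))) \<in> U"
          by (rule 2(2))
        then show ?thesis
          using pt_sh[of "-1" y t] roof by simp
      qed
      ultimately show ?thesis
        unfolding locally_in_def by blast
    qed
  qed
  have "locally_in U x s" if "x \<in> X" "pt x s \<in> U" for x s
  proof (rule locally_in_sh[where n = "idx x s"], rule base)
    show "0 \<le> s - roof (idx x s) x" "s - roof (idx x s) x < L (sh (idx x s) x 0)"
      using idx[where x = x and s = s] by (auto simp: roof_sum_Suc)
  qed (use that in \<open>auto simp: pt_sh\<close>)
  with U show "U \<subseteq> susp_reps \<Theta> L \<and> (\<forall>x\<in>X. \<forall>s. pt x s \<in> U \<longrightarrow> locally_in U x s)"
    by blast
next
  assume U: "U \<subseteq> susp_reps \<Theta> L \<and> (\<forall>x\<in>X. \<forall>s. pt x s \<in> U \<longrightarrow> locally_in U x s)"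
  have "openin (susp_domain_top \<Theta> L) {p \<in> SD. susp_quot L p \<in> U}"
    unfolding openin_susp_domain_top
  proof (intro conjI allI impI)
    fix x s assume xs: "(x, s) \<in> {p \<in> SD. susp_quot L p \<in> U}"
    then have "x \<in> X" "pt x s \<in> U"
      using susp_quot_eq_pt by (auto simp: susp_domain_def)
    with U obtain k \<delta> where k: "\<delta> > 0" "\<And>y t. y \<in> X \<Longrightarrow> agree k x y \<Longrightarrow> \<bar>t - s\<bar> < \<delta> \<Longrightarrow> pt y t \<in> U"
      unfolding locally_in_def by blast
    have "(y, t) \<in> {p \<in> SD. susp_quot L p \<in> U}" if "(y, t) \<in> SD" "agree k x y" "\<bar>t - s\<bar> < \<delta>" for y t
      using k(2)[of y t] that by (auto simp: susp_quot_eq_pt susp_domain_def)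
    with k(1) show "\<exists>k. \<exists>\<delta>>0. \<forall>y t. (y, t) \<in> SD \<longrightarrow> agree k x y \<longrightarrow> \<bar>t - s\<bar> < \<delta> \<longrightarrow>
        (y, t) \<in> {p \<in> SD. susp_quot L p \<in> U}"
      by blast
  qed blast
  with U show "openin Y U"
    by (simp add: openin_Y_top_quot)
qed

lemma topspace_Y_top: "topspace Y = susp_reps \<Theta> L"
proof -
  have "openin Y (susp_reps \<Theta> L)"
    unfolding openin_Y_top locally_in_def using pt_in_reps zero_less_one by blast
  then show ?thesis
    using openin_subset openin_Y_top by (metis openin_topspace subset_antisym)
qed

end

section \<open>Joined covers and legal words\<close>

lemma map_upto_eqD:
  assumes eq: "map x [i..j] = map y [i..j']" and "i \<le> j" "i \<le> j'"
  shows "j = j'" and "\<And>l. i \<le> l \<Longrightarrow> l \<le> j \<Longrightarrow> x l = y l"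
proof -
  show "j = j'"
    using arg_cong[OF eq, of length] assms(2,3) by simp
  with eq show "\<And>l. i \<le> l \<Longrightarrow> l \<le> j \<Longrightarrow> x l = y l"
    by auto
qed

context geom_rsubst
begin

text \<open>Compactness is applied to the product of \<open>X\<close> with \<open>{0..Lmax}\<close>,
  which contains every offset within a tile, so no metric on the hull is involved.\<close>

lemma lebesgue_number:
  assumes "open_cover Y U"
  shows "\<exists>k. \<exists>\<delta>>0. \<forall>x\<in>X. \<forall>s\<in>{0..Lmax}.
      \<exists>A\<in>U. \<forall>y\<in>X. \<forall>t. agree k x y \<longrightarrow> \<bar>t - s\<bar> < \<delta> \<longrightarrow> pt y t \<in> A"
proof -
  define nb where "nb k \<delta> x s = {(y, t). y \<in> X \<and> agree k x y \<and> \<bar>t - s\<bar> < (\<delta>::real)}" for k \<delta> x s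
  \<comment> \<open>The factor 2 is the usual margin: balls of radius \<open>\<delta>\<close> cover,
    while the doubled ball still fits into one element of \<open>U\<close>.\<close>
  define good where "good W k \<delta> \<longleftrightarrow> \<delta> > 0 \<and> (\<exists>x s. W = nb k \<delta> x s \<and>
    (\<exists>A\<in>U. \<forall>y\<in>X. \<forall>t. agree k x y \<longrightarrow> \<bar>t - s\<bar> < 2 * \<delta> \<longrightarrow> pt y t \<in> A))" for W k \<delta>
  define \<W> where "\<W> = {W. \<exists>k \<delta>. good W k \<delta>}"
  have op: "openin (prod_topology (X_top \<Theta>) euclideanreal) W" if W: "W \<in> \<W>" for W
  proof -
    obtain k \<delta> x s where W_eq: "W = nb k \<delta> x s"
      using W unfolding \<W>_def good_def by blast
    have "(z, u) \<in> W" if "(y, t) \<in> W" "z \<in> X" "agree k y z" "\<bar>u - t\<bar> < \<delta> - \<bar>t - s\<bar>" for y t z u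
    proof -
      have "\<bar>u - s\<bar> < \<delta>"
        using that(4) by linarith
      with that show ?thesis
        using agree_trans[of k x y z] by (auto simp: W_eq nb_def)
    qed
    moreover have "\<delta> - \<bar>t - s\<bar> > 0" if "(y, t) \<in> W" for y t
      using that by (simp add: W_eq nb_def)
    moreover have "W \<subseteq> X \<times> UNIV"
      by (auto simp: W_eq nb_def)
    ultimately show ?thesis
      unfolding openin_X_top_times_real by blast
  qed
  have cov: "X \<times> {0..Lmax} \<subseteq> \<Union>\<W>"
  proof clarify
    fix x s assume x: "x \<in> X"
    have "pt x s \<in> \<Union>U"
      using assms pt_in_reps[OF x] by (simp add: open_cover_def topspace_Y_top)
    then obtain A where A: "A \<in> U" "pt x s \<in> A"
      by blast
    with assms x have "locally_in A x s"
      by (auto simp: open_cover_def openin_Y_top)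
    then obtain k \<delta> where k: "\<delta> > 0" "\<forall>y\<in>X. \<forall>t. agree k x y \<longrightarrow> \<bar>t - s\<bar> < \<delta> \<longrightarrow> pt y t \<in> A"
      unfolding locally_in_def by blast
    have "good (nb k (\<delta> / 2) x s) k (\<delta> / 2)"
      unfolding good_def using k A(1) by auto
    moreover have "(x, s) \<in> nb k (\<delta> / 2) x s"
      using x k(1) by (simp add: nb_def)
    ultimately show "(x, s) \<in> \<Union>\<W>"
      unfolding \<W>_def by blast
  qed
  have "compactin (X_top \<Theta>) X"
    using compact_X_top[of \<Theta>] by (simp add: compact_space_def)
  then have "compactin (prod_topology (X_top \<Theta>) euclideanreal) (X \<times> {0..Lmax})"
    by (simp add: compactin_Times)
  then obtain F where F: "finite F" "F \<subseteq> \<W>" "X \<times> {0..Lmax} \<subseteq> \<Union>F"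
    using op cov unfolding compactin_def by meson
  have "\<forall>W\<in>F. \<exists>k \<delta>. good W k \<delta>"
    using F(2) by (auto simp: \<W>_def)
  then obtain kf df where kf: "\<And>W. W \<in> F \<Longrightarrow> good W (kf W) (df W)"
    by metis
  \<comment> \<open>The sum dominates every \<open>kf W\<close>. In the minimum below, the inserted
    1 keeps \<open>\<delta>\<close> defined for empty \<open>F\<close>.\<close>
  define k where "k = sum kf F"
  define \<delta> where "\<delta> = Min (insert 1 (df ` F))"
  have "\<delta> > 0"
    unfolding \<delta>_def using F(1) kf by (auto simp: good_def)
  moreover have "\<exists>A\<in>U. \<forall>y\<in>X. \<forall>t. agree k x y \<longrightarrow> \<bar>t - s\<bar> < \<delta> \<longrightarrow> pt y t \<in> A"
    if xs: "x \<in> X" "0 \<le> s" "s \<le> Lmax" for x s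
  proof -
    have "(x, s) \<in> \<Union>F"
      using xs by (intro subsetD[OF F(3)]) simp
    then obtain W where W: "W \<in> F" "(x, s) \<in> W"
      by blast
    have kW: "kf W \<le> k" and dW: "\<delta> \<le> df W"
      using W(1) F(1) by (auto simp: k_def \<delta>_def intro!: member_le_sum)
    obtain x0 s0 A where A: "W = nb (kf W) (df W) x0 s0" "A \<in> U"
        "\<And>y t. y \<in> X \<Longrightarrow> agree (kf W) x0 y \<Longrightarrow> \<bar>t - s0\<bar> < 2 * df W \<Longrightarrow> pt y t \<in> A"
      using kf[OF W(1)] unfolding good_def by blast
    have x0: "agree (kf W) x0 x" "\<bar>s - s0\<bar> < df W"
      using subst[OF A(1), of "\<lambda>W. (x, s) \<in> W", OF W(2)] by (auto simp: nb_def)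
    have "pt y t \<in> A" if "y \<in> X" "agree k x y" "\<bar>t - s\<bar> < \<delta>" for y t
    proof (rule A(3))
      show "agree (kf W) x0 y"
        by (rule agree_trans[OF x0(1) agree_mono[OF that(2) kW]])
    qed (use that x0(2) dW in auto)
    with A(2) show ?thesis
      by blast
  qed
  ultimately show ?thesis
    by (intro exI[of _ k] exI[of _ \<delta>]) auto
qed

lemma roof_diff_le: "m \<le> n \<Longrightarrow> roof n x - roof m x \<le> Lmax * real_of_int (n - m)"
proof (induction n rule: int_ge_induct)
  case (step i)
  have "L (x i) \<le> Lmax"
    by simp
  moreover have "Lmax * real_of_int (i + 1 - m) = Lmax * real_of_int (i - m) + Lmax"
    by (simp add: algebra_simps)
  ultimately show ?case
    unfolding roof_sum_Suc using step.IH by linarith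
qed simp

lemma wlen_map_upto: "i \<le> j \<Longrightarrow> wlen L (map x [i..j - 1]) = roof j x - roof i x"
proof (induction j rule: int_ge_induct)
  case (step j)
  then have "[i..j] = [i..j - 1] @ [j]"
    by (simp add: upto_rec2)
  with step show ?case
    by (simp add: roof_sum_Suc)
qed simp

lemma idx_mono:
  assumes "s \<le> t"
  shows "idx x s \<le> idx x t"
proof (rule ccontr)
  assume "\<not> ?thesis"
  then have "roof (idx x t + 1) x \<le> roof (idx x s) x"
    by (intro roof_mono) simp
  with idx(2)[of t x] idx(1)[of x s] assms show False
    by linarith
qed

lemma idx_nonneg: "0 \<le> s \<Longrightarrow> 0 \<le> idx x s"
proof (rule ccontr)
  assume "0 \<le> s" "\<not> 0 \<le> idx x s"
  then have "roof (idx x s + 1) x \<le> roof 0 x"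
    by (intro roof_mono) simp
  with idx(2)[of s x] \<open>0 \<le> s\<close> show False
    by simp
qed

definition lang_upto :: "real \<Rightarrow> 'a list set" where
  "lang_upto r = {w \<in> language \<Theta>. wlen L w \<le> r}"

lemma finite_lang_upto: "finite (lang_upto r)"
  by (rule finite_subset[OF _ words_bounded_wlen(1)[of r]]) (auto simp: lang_upto_def)

text \<open>Points are classified by a word with a collar of \<open>k\<close> tiles on either side
  and by the \<open>\<delta>\<close>-cell of their offset. Points of one class stay together in the
  Lebesgue sense up to time \<open>n\<close>; \<open>D\<close> counts the cells.\<close>

lemma join_cover_classes:
  assumes "open_cover Y U"
  obtains C D where "D > 0" "C \<ge> 0" "\<And>n. has_finite_subcover Y (join_cover Y T1 n U)"
    "\<And>n. min_subcover Y (join_cover Y T1 n U) \<le> card (lang_upto (real n + C)) * D"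
proof -
  from lebesgue_number[OF assms] obtain k \<delta> where \<delta>: "\<delta> > 0" and leb: "\<forall>x\<in>X. \<forall>s\<in>{0..Lmax}.
      \<exists>A\<in>U. \<forall>y\<in>X. \<forall>t. agree k x y \<longrightarrow> \<bar>t - s\<bar> < \<delta> \<longrightarrow> pt y t \<in> A"
    by (elim exE conjE)
  \<comment> \<open>The collars and tile \<open>J x\<close> make \<open>2 * k + 1\<close> tiles, and
    the target position \<open>n + Lmax\<close> overshoots by one more \<open>Lmax\<close>.\<close>
  define C where "C = Lmax * (2 * real k + 2)"
  define DS where "DS = {0..\<lfloor>Lmax / \<delta>\<rfloor>}"
  have main: "has_finite_subcover Y (join_cover Y T1 n U) \<and>
      min_subcover Y (join_cover Y T1 n U) \<le> card (lang_upto (real n + C)) * card DS" for n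
  proof -
    \<comment> \<open>An offset is below \<open>Lmax\<close>, so tile \<open>J x\<close> lies at or
      beyond every tile visited at times before \<open>n\<close>.\<close>
    define J where "J x = idx x (real n + Lmax)" for x
    have J: "J x \<ge> 0" for x
      unfolding J_def by (rule idx_nonneg) simp
    define \<Phi> where "\<Phi> = (\<lambda>(x, s). (map x [- int k..J x + int k], \<lfloor>s / \<delta>\<rfloor>))"
    let ?F = "lang_upto (real n + C) \<times> DS"
    have fin: "finite ?F"
      by (simp add: finite_lang_upto DS_def)
    have into: "\<Phi> ` topspace Y \<subseteq> ?F"
    proof (rule image_subsetI)
      fix p assume "p \<in> topspace Y"
      then obtain x s where p: "p = (x, s)" and x: "x \<in> X" and s: "0 \<le> s" "s < L (x 0)"
        by (auto simp: topspace_Y_top susp_reps_def)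
      have "s \<le> Lmax"
        using s(2) L_le_Lmax[of "x 0"] by linarith
      then have "s / \<delta> \<le> Lmax / \<delta>"
        using \<delta> by (simp add: divide_right_mono)
      then have 1: "\<lfloor>s / \<delta>\<rfloor> \<in> DS"
        using s(1) \<delta> by (simp add: DS_def floor_mono)
      let ?w = "map x [- int k..J x + int k]"
      have "wlen L ?w = roof (J x + int k + 1) x - roof (- int k) x"
        using wlen_map_upto[of "- int k" "J x + int k + 1" x] J[of x] by simp
      moreover have "roof (J x + int k + 1) x - roof (J x) x \<le> Lmax * (real k + 1)"
        using roof_diff_le[of "J x" "J x + int k + 1" x] by (simp add: algebra_simps)
      moreover have "roof 0 x - roof (- int k) x \<le> Lmax * real k"
        using roof_diff_le[of "- int k" 0 x] by simp
      moreover have "roof (J x) x \<le> real n + Lmax"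
        unfolding J_def by (rule idx)
      ultimately have "wlen L ?w \<le> real n + C"
        unfolding C_def by (simp add: algebra_simps)
      moreover have "?w \<in> language \<Theta>"
        using x J[of x] by (simp add: subshift_def)
      ultimately show "\<Phi> p \<in> ?F"
        using 1 by (simp add: p \<Phi>_def lang_upto_def)
    qed
    have sub: "A \<subseteq> topspace Y" if "A \<in> join_cover Y T1 n U" for A
      using that by (auto simp: join_cover_iff)
    have cell: "\<exists>B\<in>join_cover Y T1 n U. \<forall>p'\<in>topspace Y. \<Phi> p' = \<Phi> p \<longrightarrow> p' \<in> B"
      if p: "p \<in> topspace Y" for p
    proof -
      obtain x s where xs: "p = (x, s)"
        by (cases p)
      have x: "x \<in> X" and s: "0 \<le> s" "s < L (x 0)"
        using p xs by (auto simp: topspace_Y_top susp_reps_def)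
      define q where "q i = idx x (s + real i)" for i :: nat
      \<comment> \<open>Apply the Lebesgue number after moving the origin to tile
        \<open>q i\<close>, where the orbit is at time \<open>i\<close>.\<close>
      have "\<exists>A\<in>U. \<forall>y\<in>X. \<forall>t. agree k (sh (q i) x) y \<longrightarrow> \<bar>t - (s + real i - roof (q i) x)\<bar> < \<delta> \<longrightarrow> pt y t \<in> A" for i
      proof (rule leb[rule_format])
        have "0 \<le> s + real i - roof (q i) x"
          using idx(1)[of x "s + real i"] by (simp add: q_def)
        moreover have "s + real i < roof (q i) x + L (x (q i))"
          using idx(2)[of "s + real i" x] by (simp add: q_def roof_sum_Suc)
        then have "s + real i - roof (q i) x \<le> Lmax"
          using L_le_Lmax[of "x (q i)"] by linarith
        ultimately show "s + real i - roof (q i) x \<in> {0..Lmax}"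
          by simp
      qed (use x in simp)
      then obtain A where A: "\<And>i. A i \<in> U" "\<And>i y t. y \<in> X \<Longrightarrow> agree k (sh (q i) x) y \<Longrightarrow>
          \<bar>t - (s + real i - roof (q i) x)\<bar> < \<delta> \<Longrightarrow> pt y t \<in> A i"
        by metis
      let ?B = "{y \<in> topspace Y. \<forall>i<n. (T1 ^^ i) y \<in> A i}"
      have "p' \<in> ?B" if p': "p' \<in> topspace Y" "\<Phi> p' = \<Phi> p" for p'
      proof -
        obtain x' s' where xs': "p' = (x', s')"
          by (cases p')
        have x': "x' \<in> X" and s': "0 \<le> s'" "s' < L (x' 0)"
          using p'(1) xs' by (auto simp: topspace_Y_top susp_reps_def)
        have words: "map x [- int k..J x + int k] = map x' [- int k..J x' + int k]"
          and fl: "\<lfloor>s / \<delta>\<rfloor> = \<lfloor>s' / \<delta>\<rfloor>"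
          using p'(2) by (auto simp: xs xs' \<Phi>_def)
        have eq: "x l = x' l" if "- int k \<le> l" "l \<le> J x + int k" for l
          by (rule map_upto_eqD(2)[OF words]) (use that J[of x] J[of x'] in auto)
        have "\<bar>s' / \<delta> - s / \<delta>\<bar> < 1"
          using fl by linarith
        then have "\<bar>(s' - s) / \<delta>\<bar> < 1"
          by (simp add: diff_divide_distrib)
        then have ss: "\<bar>s' - s\<bar> < \<delta>"
          using \<delta> by (simp add: abs_divide)
        have "(T1 ^^ i) p' \<in> A i" if i: "i < n" for i
        proof -
          have q0: "0 \<le> q i"
            unfolding q_def by (rule idx_nonneg) (use s in simp)
          have qJ: "q i \<le> J x"
            unfolding q_def J_def by (rule idx_mono) (use s(2) L_le_Lmax[of "x 0"] i in linarith)
          have roof: "roof (q i) x' = roof (q i) x"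
            unfolding roof_sum_def using q0 qJ by (auto intro!: sum.cong simp: eq)
          have "agree k (sh (q i) x) (sh (q i) x')"
            using q0 qJ by (auto simp: agree_def intro!: eq)
          then have "pt (sh (q i) x') (s' + real i - roof (q i) x') \<in> A i"
            using x' ss roof by (intro A(2)) auto
          then have "pt x' (s' + real i) \<in> A i"
            by (simp add: pt_sh)
          moreover have "p' = pt x' s'"
            using s' by (simp add: xs' pt_base)
          ultimately show ?thesis
            by (simp add: T1_pow_pt[OF x'])
        qed
        with p'(1) show ?thesis
          by blast
      qed
      moreover have "?B \<in> join_cover Y T1 n U"
        unfolding join_cover_iff using A(1) by blast
      ultimately show ?thesis
        by blast
    qed
    show ?thesis
      using finite_classes_imp_subcover[OF fin into sub cell] by (simp add: card_cartesian_product)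
  qed
  show thesis
  proof (rule that[of "card DS" C])
    show "card DS > 0"
      using \<delta> by (simp add: DS_def card_gt_0_iff)
    show "C \<ge> 0"
      by (simp add: C_def)
  qed (use main in auto)
qed

section \<open>Desubstitution and the number of legal words\<close>

lemma full_words:
  shows "\<exists>N. \<forall>p\<ge>N. \<forall>a b. \<exists>w1 w2. w1 @ b # w2 \<in> subst_pow \<Theta> p a"
proof -
  obtain N where N: "\<And>p a. p \<ge> N \<Longrightarrow> \<exists>w \<in> subst_pow \<Theta> p a. set w = UNIV"
    using primitive_imp_full_words[OF rs prim] by blast
  have "\<exists>w1 w2. w1 @ b # w2 \<in> subst_pow \<Theta> p a" if "p \<ge> N" for p a b
    using N[OF that, of a] by (metis UNIV_I split_list)
  then show ?thesis
    by blast
qed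

lemma subst_word_pow_exists: "\<exists>v. v \<in> subst_word (subst_pow \<Theta> m) u"
  using subst_word_nonempty[of "subst_pow \<Theta> m" u] by auto

lemma subst_pow_in_context:
  assumes "u1 @ b # u2 \<in> subst_pow \<Theta> p a" "v \<in> subst_pow \<Theta> m b"
  shows "\<exists>v1 v2. v1 @ v @ v2 \<in> subst_pow \<Theta> (p + m) a \<and> length u1 \<le> length v1 \<and> length u2 \<le> length v2"
proof -
  obtain v1 v2 where v12: "v1 \<in> subst_word (subst_pow \<Theta> m) u1" "v2 \<in> subst_word (subst_pow \<Theta> m) u2"
    using subst_word_pow_exists by blast
  have "v1 @ v @ v2 \<in> subst_word (subst_pow \<Theta> m) (u1 @ b # u2)"
    by (intro subst_word_appendI subst_word_ConsI v12 assms)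
  then have "v1 @ v @ v2 \<in> subst_pow \<Theta> (p + m) a"
    by (rule subst_pow_addI[OF assms(1)])
  moreover have "length u1 \<le> length v1" "length u2 \<le> length v2"
    using v12 by (auto intro: length_subst_word[where \<Theta> = "subst_pow \<Theta> m"])
  ultimately show ?thesis
    by blast
qed

text \<open>A legal word may come from a level \<open>n\<close> below \<open>m\<close>. Primitivity
  puts its ancestor \<open>a\<close> into a word of level \<open>N + m\<close>; of the resulting
  \<open>N + n + m\<close> steps the last \<open>m\<close> are split off.\<close>

lemma language_desubstitute:
  assumes "w \<in> language \<Theta>"
  shows "\<exists>u p q. p @ w @ q \<in> subst_word (subst_pow \<Theta> m) u"
proof -
  obtain n a u1 u2 where v: "u1 @ w @ u2 \<in> subst_pow \<Theta> n a"
    using assms unfolding language_def by blast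
  from full_words obtain N w1 w2 where "w1 @ a # w2 \<in> subst_pow \<Theta> (N + m) a"
    by (meson le_add1)
  from subst_pow_in_context[OF this v] obtain v1 v2 where
    "v1 @ (u1 @ w @ u2) @ v2 \<in> subst_pow \<Theta> (N + m + n) a"
    by blast
  then have "(v1 @ u1) @ w @ (u2 @ v2) \<in> subst_pow \<Theta> ((N + n) + m) a"
    by (simp add: ac_simps)
  then show ?thesis
    unfolding subst_pow_add by blast
qed

lemma prefix_wlen_less:
  assumes "v1 @ v2 = p @ r" "wlen L v1 < wlen L p"
  shows "\<exists>p'. p = v1 @ p' \<and> v2 = p' @ r"
proof -
  from assms(1) consider us where "v1 = p @ us" "us @ v2 = r" | us where "p = v1 @ us" "v2 = us @ r"
    by (auto simp: append_eq_append_conv2)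
  then show ?thesis
  proof cases
    case 1
    with assms(2) wlen_nonneg[of us] show ?thesis
      by simp
  qed auto
qed

lemma suffix_wlen_less:
  assumes "v1 @ v2 = r @ q" "wlen L v2 < wlen L q"
  shows "\<exists>q'. q = q' @ v2 \<and> v1 = r @ q'"
proof -
  from assms(1) consider us where "v1 = r @ us" "us @ v2 = q" | us where "r = v1 @ us" "v2 = us @ q"
    by (auto simp: append_eq_append_conv2)
  then show ?thesis
  proof cases
    case 2
    with assms(2) wlen_nonneg[of us] show ?thesis
      by simp
  qed auto
qed

lemma short_desubstitution:
  assumes "p @ w @ q \<in> subst_word (subst_pow \<Theta> m) u"
  shows "\<exists>u p q. p @ w @ q \<in> subst_word (subst_pow \<Theta> m) u \<and> wlen L u \<le> wlen L w / lam ^ m + 2 * Lmax"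
  using assms
proof (induction "length u" arbitrary: u p q)
  case 0
  then have "wlen L u \<le> wlen L w / lam ^ m + 2 * Lmax"
    by (simp add: add_nonneg_nonneg)
  with "0.prems" show ?case
    by blast
next
  case (Suc n)
  show ?case
  proof (cases "wlen L u \<le> wlen L w / lam ^ m + 2 * Lmax")
    case True
    with Suc.prems show ?thesis
      by blast
  next
    case False
    then have "lam ^ m * (wlen L w / lam ^ m + 2 * Lmax) < lam ^ m * wlen L u"
      by simp
    then have "wlen L w + 2 * (lam ^ m * Lmax) < lam ^ m * wlen L u"
      by (simp add: ring_distribs)
    also have "\<dots> = wlen L p + wlen L w + wlen L q"
      using wlen_subst_word_pow[OF Suc.prems] by simp
    finally consider "lam ^ m * Lmax < wlen L p" | "lam ^ m * Lmax < wlen L q"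
      by linarith
    then show ?thesis
    proof cases
      case 1
      obtain a u' where u: "u = a # u'" "length u' = n"
        using Suc.hyps(2) by (metis Suc_length_conv)
      obtain v1 v2 where v: "p @ w @ q = v1 @ v2" "v1 \<in> subst_pow \<Theta> m a" "v2 \<in> subst_word (subst_pow \<Theta> m) u'"
        using Suc.prems u(1) by (auto elim: subst_word_ConsE)
      have "wlen L v1 \<le> lam ^ m * Lmax"
        using wlen_subst_pow[OF v(2)] by (simp add: mult_left_mono)
      with 1 prefix_wlen_less[of v1 v2 p "w @ q"] v(1) obtain p' where "v2 = p' @ w @ q"
        by auto
      with Suc.hyps(1)[of u' p' q] u(2) v(3) show ?thesis
        by auto
    next
      case 2
      obtain a u' where u: "u = u' @ [a]" "length u' = n"
        using Suc.hyps(2) by (metis length_Suc_conv_rev)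
      obtain v1 v2 where v: "p @ w @ q = v1 @ v2" "v1 \<in> subst_word (subst_pow \<Theta> m) u'" "v2 \<in> subst_pow \<Theta> m a"
        using Suc.prems u(1) by (auto elim: subst_word_appendE)
      have "wlen L v2 \<le> lam ^ m * Lmax"
        using wlen_subst_pow[OF v(3)] by (simp add: mult_left_mono)
      with 2 suffix_wlen_less[of v1 v2 "p @ w" q] v(1) obtain q' where "v1 = p @ w @ q'"
        by auto
      with Suc.hyps(1)[of u' p q'] u(2) v(2) show ?thesis
        by auto
    qed
  qed
qed

text \<open>The factors count the words \<open>u\<close> of length at most \<open>R\<close>, the
  elements of level \<open>m\<close> over each \<open>u\<close>, and the pairs of start and length
  that cut \<open>w\<close> out of such an element.\<close>

lemma card_lang_upto_le:
  fixes m :: nat and r :: real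
  assumes "r \<ge> 0"
  defines "R \<equiv> r / lam ^ m + 2 * Lmax"
  shows "real (card (lang_upto r)) \<le>
    exp (\<kappa> * R) * (exp (gmax m * (lam ^ m * R)) * (lam ^ m * R / Lmin + 1) ^ 2)"
proof -
  \<comment> \<open>Bounds the number of letters of an element of level \<open>m\<close> over
    \<open>u\<close>, hence both the start and the length of the factor.\<close>
  define B where "B = nat \<lfloor>lam ^ m * R / Lmin\<rfloor>"
  have R: "R \<ge> 0"
    using assms by (simp add: add_nonneg_nonneg)
  define S where "S u = (\<lambda>(v, i, j). take j (drop i v)) ` (subst_word (subst_pow \<Theta> m) u \<times> {..B} \<times> {..B})" for u
  have "lang_upto r \<subseteq> (\<Union>u\<in>{u. wlen L u \<le> R}. S u)"
  proof
    fix w assume "w \<in> lang_upto r"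
    then have w: "w \<in> language \<Theta>" "wlen L w \<le> r"
      by (auto simp: lang_upto_def)
    obtain u p q where u: "p @ w @ q \<in> subst_word (subst_pow \<Theta> m) u" "wlen L u \<le> wlen L w / lam ^ m + 2 * Lmax"
      using language_desubstitute[OF w(1)] short_desubstitution by blast
    have uR: "wlen L u \<le> R"
      using u(2) divide_right_mono[OF w(2), of "lam ^ m"] by (simp add: R_def)
    have "Lmin * real (length (p @ w @ q)) \<le> lam ^ m * R"
      using order_trans[OF wlen_ge[of "p @ w @ q"], unfolded wlen_subst_word_pow[OF u(1)]]
        mult_left_mono[OF uR, of "lam ^ m"] by simp
    then have "real (length (p @ w @ q)) \<le> lam ^ m * R / Lmin"
      by (simp add: pos_le_divide_eq mult.commute)
    then have "length (p @ w @ q) \<le> B"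
      unfolding B_def by (rule le_nat_floor)
    then have "w \<in> S u"
      unfolding S_def using u(1) by (intro image_eqI[of _ _ "(p @ w @ q, length p, length w)"]) auto
    with uR show "w \<in> (\<Union>u\<in>{u. wlen L u \<le> R}. S u)"
      by blast
  qed
  moreover have fin: "finite (subst_word (subst_pow \<Theta> m) u)" for u
    by (rule finite_subst_word) simp
  ultimately have "card (lang_upto r) \<le> card (\<Union>u\<in>{u. wlen L u \<le> R}. S u)"
    by (intro card_mono) (auto simp: words_bounded_wlen S_def)
  also have "\<dots> \<le> (\<Sum>u\<in>{u. wlen L u \<le> R}. card (S u))"
    by (rule card_UN_le[OF words_bounded_wlen(1)])
  finally have "real (card (lang_upto r)) \<le> (\<Sum>u\<in>{u. wlen L u \<le> R}. real (card (S u)))"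
    by (metis of_nat_le_iff of_nat_sum)
  also have "\<dots> \<le> (\<Sum>u\<in>{u. wlen L u \<le> R}. exp (gmax m * (lam ^ m * R)) * (lam ^ m * R / Lmin + 1) ^ 2)"
  proof (rule sum_mono)
    fix u assume "u \<in> {u. wlen L u \<le> R}"
    then have uR: "wlen L u \<le> R"
      by simp
    have pos: "card (subst_word (subst_pow \<Theta> m) u) > 0"
      using fin by (simp add: card_gt_0_iff subst_word_nonempty)
    have "ln (real (card (subst_word (subst_pow \<Theta> m) u))) \<le> lam ^ m * (gmax m * wlen L u)"
      unfolding ln_card_subst_word_pow by (intro mult_left_mono sum_list_weighted_le) auto
    also have "\<dots> \<le> lam ^ m * (gmax m * R)"
      using uR gmax_nonneg by (intro mult_left_mono) auto
    finally have "exp (ln (real (card (subst_word (subst_pow \<Theta> m) u)))) \<le> exp (gmax m * (lam ^ m * R))"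
      by (simp only: exp_le_cancel_iff ac_simps)
    then have 1: "real (card (subst_word (subst_pow \<Theta> m) u)) \<le> exp (gmax m * (lam ^ m * R))"
      using pos by simp
    have "real B \<le> lam ^ m * R / Lmin"
      unfolding B_def using R by simp
    then have 2: "(real B + 1) ^ 2 \<le> (lam ^ m * R / Lmin + 1) ^ 2"
      by (intro power_mono) auto
    have "card (S u) \<le> card (subst_word (subst_pow \<Theta> m) u \<times> {..B} \<times> {..B})"
      unfolding S_def by (rule card_image_le) (simp add: fin)
    also have "\<dots> = card (subst_word (subst_pow \<Theta> m) u) * (B + 1) ^ 2"
      by (simp add: card_cartesian_product power2_eq_square)
    finally have "real (card (S u)) \<le> real (card (subst_word (subst_pow \<Theta> m) u) * (B + 1) ^ 2)"
      by (rule of_nat_mono)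
    also have "\<dots> = real (card (subst_word (subst_pow \<Theta> m) u)) * (real B + 1) ^ 2"
      by (simp add: add.commute)
    also have "\<dots> \<le> exp (gmax m * (lam ^ m * R)) * (lam ^ m * R / Lmin + 1) ^ 2"
      by (intro mult_mono 1 2) auto
    finally show "real (card (S u)) \<le> exp (gmax m * (lam ^ m * R)) * (lam ^ m * R / Lmin + 1) ^ 2" .
  qed
  also have "\<dots> = real (card {u. wlen L u \<le> R}) * (exp (gmax m * (lam ^ m * R)) * (lam ^ m * R / Lmin + 1) ^ 2)"
    by simp
  also have "\<dots> \<le> exp (\<kappa> * R) * (exp (gmax m * (lam ^ m * R)) * (lam ^ m * R / Lmin + 1) ^ 2)"
    using words_bounded_wlen(2)[of R] R by (intro mult_right_mono) (auto simp: max_def)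
  finally show ?thesis .
qed

end

section \<open>Entropy of the suspension flow\<close>

context geom_rsubst
begin

section \<open>Upper bound for the entropy of a cover\<close>

lemma T1_in_topspace:
  assumes y: "y \<in> topspace Y"
  shows "T1 y \<in> topspace Y"
proof -
  obtain x s where "x \<in> X" "y = pt x s"
    using y reps_eq_pt unfolding topspace_Y_top by metis
  then show ?thesis
    using T1_pow_pt[of x 1 s] pt_in_reps[of x "s + 1"] by (simp add: topspace_Y_top)
qed

text \<open>Per unit of time \<open>R\<close> grows like \<open>1 / lam ^ m\<close>: choosing
  \<open>u\<close> costs \<open>\<kappa> / lam ^ m\<close> and choosing its image costs
  \<open>gmax m\<close>. Offset cells and cut positions contribute only constants and
  logarithms.\<close>

lemma cover_entropy_le_gmax:
  assumes U: "open_cover Y U" and ne: "topspace Y \<noteq> {}"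
  shows "cover_entropy Y T1 U \<le> gmax m + \<kappa> / lam ^ m"
proof -
  obtain C D where D: "D > 0" and C: "C \<ge> 0" and fin: "\<And>n. has_finite_subcover Y (join_cover Y T1 n U)"
    and le: "\<And>n. min_subcover Y (join_cover Y T1 n U) \<le> card (lang_upto (real n + C)) * D"
    using join_cover_classes[OF U] by metis
  let ?N = "\<lambda>n. min_subcover Y (join_cover Y T1 n U)"
  define M where "M = lam ^ m"
  have M: "M > 0"
    by (simp add: M_def)
  define c where "c = C / M + 2 * Lmax"
  have c: "c \<ge> 0"
    using C M by (simp add: c_def)
  \<comment> \<open>Chosen so that \<open>M * R / Lmin + 1 \<le> t * \<gamma>\<close> for
    \<open>t \<ge> 1\<close>, which splits the logarithm of the number of cuts.\<close>
  define \<gamma> where "\<gamma> = (1 + M * c) / Lmin + 1"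
  have \<gamma>: "\<gamma> > 0"
    using M c by (simp add: \<gamma>_def add_nonneg_pos)
  define b where "b n = (ln (real D) + 2 * ln \<gamma>) * inverse (real (Suc n))
    + (\<kappa> + gmax m * M) * (1 / M + c * inverse (real (Suc n))) + 2 * (ln (real (Suc n)) / real (Suc n))" for n
  have "ln (real (?N (Suc n))) / real (Suc n) \<le> b n" for n
  proof -
    define t where "t = real (Suc n)"
    have t: "t \<ge> 1"
      by (simp add: t_def)
    define R where "R = (t + C) / lam ^ m + 2 * Lmax"
    have R_eq: "R = t / M + c"
      by (simp add: R_def c_def M_def add_divide_distrib)
    let ?c = "card (lang_upto (t + C))"
    have N: "?N (Suc n) > 0"
      by (rule min_subcover_pos[OF fin ne])
    have NcD: "?N (Suc n) \<le> ?c * D"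
      using le[of "Suc n"] by (simp add: t_def)
    with N have cpos: "?c > 0"
      by (metis gr0I mult_0 not_le)
    have "real (?N (Suc n)) \<le> real ?c * real D"
      using NcD by (metis of_nat_le_iff of_nat_mult)
    then have "ln (real (?N (Suc n))) \<le> ln (real ?c * real D)"
      using N by (intro ln_mono) auto
    also have "\<dots> = ln (real ?c) + ln (real D)"
      using cpos D by (simp add: ln_mult)
    also have "ln (real ?c) \<le> \<kappa> * R + (gmax m * (M * R) + 2 * (ln t + ln \<gamma>))"
    proof -
      have MR: "M * R = t + M * c"
        using M by (simp add: R_eq ring_distribs)
      have pos: "M * R / Lmin + 1 > 0"
        using M c t by (simp add: MR add_nonneg_pos)
      have "M * c \<le> t * (M * c)"
        using mult_right_mono[OF t, of "M * c"] M c by simp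
      then have "M * R \<le> t * (1 + M * c)"
        unfolding MR by (simp add: ring_distribs)
      then have "M * R / Lmin \<le> t * (1 + M * c) / Lmin"
        by (rule divide_right_mono) simp
      then have "M * R / Lmin + 1 \<le> t * \<gamma>"
        unfolding \<gamma>_def using t by (simp add: ring_distribs)
      then have "ln (M * R / Lmin + 1) \<le> ln (t * \<gamma>)"
        using pos by (intro ln_mono) auto
      also have "\<dots> = ln t + ln \<gamma>"
        using t \<gamma> by (simp add: ln_mult)
      finally have lnMR: "ln (M * R / Lmin + 1) \<le> ln t + ln \<gamma>" .
      have "real ?c \<le> exp (\<kappa> * R) * (exp (gmax m * (M * R)) * (M * R / Lmin + 1) ^ 2)"
        unfolding M_def R_def using card_lang_upto_le[of "t + C" m] t C by simp
      then have "ln (real ?c) \<le> ln (exp (\<kappa> * R) * (exp (gmax m * (M * R)) * (M * R / Lmin + 1) ^ 2))"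
        using cpos by (intro ln_mono) auto
      also have "\<dots> = \<kappa> * R + (gmax m * (M * R) + 2 * ln (M * R / Lmin + 1))"
        using pos by (simp add: ln_mult ln_realpow)
      finally show ?thesis
        by (rule order_trans) (use lnMR in simp)
    qed
    finally have "ln (real (?N (Suc n))) / t
        \<le> (\<kappa> * R + (gmax m * (M * R) + 2 * (ln t + ln \<gamma>)) + ln (real D)) / t"
      using t by (intro divide_right_mono) auto
    also have "\<dots> = b n"
      unfolding b_def t_def[symmetric] R_eq using t M by (simp add: field_simps)
    finally show ?thesis
      by (simp add: t_def)
  qed
  moreover have "b \<longlonglongrightarrow> (ln (real D) + 2 * ln \<gamma>) * 0 + (\<kappa> + gmax m * M) * (1 / M + c * 0) + 2 * 0"
    unfolding b_def by (intro tendsto_intros LIMSEQ_inverse_real_of_nat LIMSEQ_Suc[OF lim_ln_over_n])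
  then have "b \<longlonglongrightarrow> gmax m + \<kappa> / lam ^ m"
    using M by (simp add: add_divide_distrib M_def add.commute)
  ultimately show ?thesis
    using LIMSEQ_le[OF cover_entropy_tendsto[OF T1_in_topspace ne fin]] by blast
qed

section \<open>Realising substituted words in the subshift\<close>

lemma long_words: "\<exists>p. \<forall>w\<in>subst_pow \<Theta> p a. length w \<ge> K"
proof -
  obtain p where p: "real K * Lmax / L a < lam ^ p"
    using real_arch_pow[OF lam_gt_1] by blast
  have "length w \<ge> K" if "w \<in> subst_pow \<Theta> p a" for w
  proof -
    have "real K * Lmax < lam ^ p * L a"
      using p by (simp add: divide_less_eq)
    also have "\<dots> \<le> Lmax * real (length w)"
      using wlen_le[of w] wlen_subst_pow[OF that] by simp
    finally have "Lmax * real K < Lmax * real (length w)"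
      by (simp add: mult.commute)
    then show ?thesis
      by simp
  qed
  then show ?thesis
    by blast
qed

text \<open>In a long word of some level the letter \<open>c\<close> has \<open>K\<close> letters on
  either side. Passing from \<open>c\<close> to \<open>a\<close> and from \<open>a\<close> to
  \<open>v\<close> never shortens these margins, which are trimmed at the end.\<close>

lemma word_extends:
  assumes v: "v \<in> subst_pow \<Theta> m a"
  shows "\<exists>u1 u2. length u1 = K \<and> length u2 = K \<and> u1 @ v @ u2 \<in> language \<Theta>"
proof -
  obtain p where p: "\<forall>w\<in>subst_pow \<Theta> p a. length w \<ge> 2 * K + 1"
    using long_words by blast
  obtain W where W: "W \<in> subst_pow \<Theta> p a"
    using pow_nonempty by blast
  with p have len: "length W \<ge> 2 * K + 1"
    by blast
  define W1 c W2 where "W1 = take K W" and "c = W ! K" and "W2 = drop (Suc K) W"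
  have W12: "W1 @ c # W2 \<in> subst_pow \<Theta> p a" "length W1 \<ge> K" "length W2 \<ge> K"
    using W len by (auto simp: W1_def c_def W2_def id_take_nth_drop[symmetric])
  \<comment> \<open>The successor makes the total level at least 1, as \<open>language\<close>
    demands.\<close>
  obtain N z1 z2 where z: "z1 @ a # z2 \<in> subst_pow \<Theta> (Suc N) c"
    using full_words by (meson le_SucI order_refl)
  obtain y1 y2 where y: "y1 @ (z1 @ a # z2) @ y2 \<in> subst_pow \<Theta> (p + Suc N) a"
      "length W1 \<le> length y1" "length W2 \<le> length y2"
    using subst_pow_in_context[OF W12(1) z] by blast
  then have "(y1 @ z1) @ a # (z2 @ y2) \<in> subst_pow \<Theta> (p + Suc N) a"
    by simp
  from subst_pow_in_context[OF this v] obtain t1 t2 where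
    t: "t1 @ v @ t2 \<in> subst_pow \<Theta> (p + Suc N + m) a" "length (y1 @ z1) \<le> length t1" "length (z2 @ y2) \<le> length t2"
    by blast
  define u1 u2 where "u1 = drop (length t1 - K) t1" and "u2 = take K t2"
  have len: "length u1 = K" "length u2 = K"
    using t W12 y by (auto simp: u1_def u2_def)
  have "take (length t1 - K) t1 @ u1 = t1" "u2 @ drop K t2 = t2"
    by (simp_all add: u1_def u2_def)
  then have split: "t1 @ v @ t2 = take (length t1 - K) t1 @ (u1 @ v @ u2) @ drop K t2"
    by (metis append.assoc)
  have "v \<noteq> []"
    using v by (metis pow_Nil)
  have "t1 @ v @ t2 \<in> language \<Theta>"
    unfolding language_def mem_Collect_eq
  proof (intro conjI exI bexI)
    show "p + Suc N + m \<ge> 1" "t1 @ v @ t2 = [] @ (t1 @ v @ t2) @ []"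
      by simp_all
  qed (use t(1) \<open>v \<noteq> []\<close> in auto)
  then have "u1 @ v @ u2 \<in> language \<Theta>"
    unfolding split by (rule language_sublist) (use \<open>v \<noteq> []\<close> in simp)
  with len show ?thesis
    by blast
qed

lemma word_realized:
  assumes "v \<in> subst_pow \<Theta> m a"
  shows "\<exists>x\<in>X. map x [0..int (length v) - 1] = v"
  by (rule subshift_point_exists) (rule word_extends[OF assms])

lemma topspace_Y_nonempty: "topspace Y \<noteq> {}"
proof -
  obtain x where "x \<in> X"
    using word_realized[of "[undefined]" 0 undefined] by auto
  then show ?thesis
    using pt_in_reps[of x 0] by (auto simp: topspace_Y_top)
qed

text \<open>The \<open>\<delta>\<close>-thickened cylinders, with \<open>2 * \<delta> = Lmin\<close> and a window wide enough to cover one unit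
  of time: a tile boundary at a known position cannot be confused with a neighbouring one, so the
  itinerary of \<open>(x, 0)\<close> determines the letters of \<open>x\<close> one after the other.\<close>

definition patch :: "nat \<Rightarrow> (int \<Rightarrow> 'a) \<Rightarrow> real \<Rightarrow> ((int \<Rightarrow> 'a) \<times> real) set" where
  "patch k z s = {pt y t | y t. y \<in> X \<and> agree k z y \<and> \<bar>t - s\<bar> < Lmin / 2}"

definition patch_cover :: "nat \<Rightarrow> ((int \<Rightarrow> 'a) \<times> real) set set" where
  "patch_cover k = {patch k z s | z s. z \<in> X \<and> 0 \<le> s \<and> s \<le> Lmax}"

lemma patchE:
  assumes "pt x t \<in> patch k z s"
  obtains p where "agree k z (sh p x)" "\<bar>t - roof p x - s\<bar> < Lmin / 2"
proof -
  obtain y u where "pt x t = pt y u" "agree k z y" "\<bar>u - s\<bar> < Lmin / 2"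
    using assms unfolding patch_def by blast
  with pt_eqD that show thesis
    by blast
qed

lemma patch_open: "openin Y (patch k z s)"
  unfolding openin_Y_top
proof (intro conjI ballI allI impI)
  show "patch k z s \<subseteq> susp_reps \<Theta> L"
    using pt_in_reps by (auto simp: patch_def)
  fix x t assume "x \<in> X" "pt x t \<in> patch k z s"
  then obtain p where p: "agree k z (sh p x)" "\<bar>t - roof p x - s\<bar> < Lmin / 2"
    by (auto elim: patchE)
  have "pt y u \<in> patch k z s"
    if "y \<in> X" "agree k (sh p x) y" "\<bar>u - (t - roof p x)\<bar> < Lmin / 2 - \<bar>t - roof p x - s\<bar>" for y u
  proof -
    have "\<bar>u - s\<bar> < Lmin / 2"
      using that(3) by linarith
    with that agree_trans[OF p(1) that(2)] show ?thesis
      unfolding patch_def by blast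
  qed
  moreover have "Lmin / 2 - \<bar>t - roof p x - s\<bar> > 0"
    using p(2) by simp
  ultimately have "locally_in (patch k z s) (sh p x) (t - roof p x)"
    unfolding locally_in_def by blast
  then show "locally_in (patch k z s) x t"
    by (rule locally_in_sh)
qed

lemma patch_cover_open_cover: "open_cover Y (patch_cover k)"
proof -
  have "p \<in> \<Union>(patch_cover k)" if p: "p \<in> topspace Y" for p
  proof -
    obtain x s where xs: "x \<in> X" "0 \<le> s" "s < L (x 0)" "p = pt x s"
      using reps_eq_pt[OF p[unfolded topspace_Y_top]] .
    have "s \<le> Lmax"
      using xs(3) L_le_Lmax[of "x 0"] by linarith
    moreover have "p \<in> patch k x s"
      unfolding patch_def xs(4) mem_Collect_eq using xs(1) by (intro exI[of _ x] exI[of _ s]) simp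
    ultimately show ?thesis
      using xs(1,2) unfolding patch_cover_def by blast
  qed
  moreover have "\<forall>A\<in>patch_cover k. openin Y A"
    using patch_open by (auto simp: patch_cover_def)
  ultimately show ?thesis
    unfolding open_cover_def using openin_subset by blast
qed

text \<open>Once the earlier letters agree, tile \<open>j\<close> starts at the same
  \<open>r\<close> in both points. A common patch matches it with tiles of \<open>z\<close> starting
  within \<open>Lmin / 2\<close> of one position; two such starts are closer than
  \<open>Lmin\<close>, so they coincide.\<close>

lemma patch_separates:
  assumes k: "real k \<ge> (1 + Lmax + Lmin / 2) / Lmin"
    and B: "B \<in> join_cover Y T1 n (patch_cover k)" "pt x 0 \<in> B" "pt x' 0 \<in> B"
    and x: "x \<in> X" "x' \<in> X" and j: "roof (int j) x < real n"
  shows "x (int j) = x' (int j)"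
  using j
proof (induction j rule: less_induct)
  case (less j)
  have eq: "x l = x' l" if "0 \<le> l" "l < int j" for l
    using less.IH[of "nat l"] that less.prems roof_mono[of l "int j" x] by simp
  define r where "r = roof (int j) x"
  have r: "r = roof (int j) x'"
    unfolding r_def roof_sum_def using eq by (auto intro!: sum.cong)
  have r0: "0 \<le> r" "r < real n"
    using less.prems roof_mono[of 0 "int j" x] by (auto simp: r_def)
  \<comment> \<open>The last sampling time not after the start of tile \<open>j\<close>; it precedes
    \<open>n\<close> because \<open>r\<close> does.\<close>
  define i where "i = nat \<lfloor>r\<rfloor>"
  have i: "real i \<le> r" "r < real i + 1"
    using r0 unfolding i_def by linarith+
  then have "i < n"
    using r0(2) by linarith
  obtain A where A: "B = {y \<in> topspace Y. \<forall>i<n. (T1 ^^ i) y \<in> A i}" "\<forall>i<n. A i \<in> patch_cover k"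
    using B(1) unfolding join_cover_iff by (elim exE conjE)
  from A(2) \<open>i < n\<close> obtain z s where zs: "A i = patch k z s" "0 \<le> s" "s \<le> Lmax"
    unfolding patch_cover_def by blast
  have *: "\<exists>q. \<bar>q\<bar> \<le> int k \<and> y (int j) = z q \<and> \<bar>roof q z - (r - real i + s)\<bar> < Lmin / 2"
    if y: "y \<in> X" "pt y 0 \<in> B" "r = roof (int j) y" for y
  proof -
    have "(T1 ^^ i) (pt y 0) \<in> patch k z s"
      using y(2) \<open>i < n\<close> zs(1) A(1) by auto
    then have "pt y (real i) \<in> patch k z s"
      using T1_pow_pt[OF y(1), of i 0] by simp
    then obtain p where p: "agree k z (sh p y)" "\<bar>real i - roof p y - s\<bar> < Lmin / 2"
      by (rule patchE)
    define q where "q = int j - p"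
    have rq: "roof q (sh p y) = r - roof p y"
      using roof_sum_add[of L p q y] y(3) by (simp add: q_def)
    \<comment> \<open>Tile \<open>j\<close> of \<open>y\<close> starts at most
      \<open>1 + Lmax + Lmin / 2\<close> from the origin of \<open>z\<close>, from waiting time,
      offset and tolerance; the bound on \<open>k\<close> keeps it in the window.\<close>
    have "Lmin * \<bar>real_of_int q\<bar> \<le> \<bar>r - roof p y\<bar>"
      using abs_roof_diff_ge[of q 0 "sh p y"] rq by simp
    also have "\<dots> \<le> 1 + Lmax + Lmin / 2"
      using p(2) i zs(2,3) by linarith
    finally have "\<bar>real_of_int q\<bar> \<le> (1 + Lmax + Lmin / 2) / Lmin"
      by (simp add: pos_le_divide_eq mult.commute)
    then have qk: "\<bar>q\<bar> \<le> int k"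
      using k by linarith
    have "roof q z = r - roof p y"
      using roof_sum_agree[OF p(1) qk] rq by simp
    then have "\<bar>roof q z - (r - real i + s)\<bar> < Lmin / 2"
      using p(2) by linarith
    moreover have "y (int j) = z q"
      using p(1) qk by (auto simp: agree_def q_def)
    ultimately show ?thesis
      using qk by blast
  qed
  obtain q where q: "x (int j) = z q" "\<bar>roof q z - (r - real i + s)\<bar> < Lmin / 2"
    using *[OF x(1) B(2) r_def] by blast
  obtain q' where q': "x' (int j) = z q'" "\<bar>roof q' z - (r - real i + s)\<bar> < Lmin / 2"
    using *[OF x(2) B(3) r] by blast
  have "Lmin * \<bar>real_of_int (q - q')\<bar> \<le> \<bar>roof q z - roof q' z\<bar>"
    by (rule abs_roof_diff_ge)
  also have "\<dots> < Lmin"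
    using q(2) q'(2) by linarith
  finally have "q = q'"
    by simp
  with q q' show ?case
    by simp
qed

section \<open>Lower bound from separated orbits\<close>

lemma prefix_same_wlen:
  assumes "wlen L v = wlen L w" "length v \<le> length w" "\<And>j. j < length v \<Longrightarrow> v ! j = w ! j"
  shows "v = w"
proof -
  have "take (length v) w = v"
    using assms(2,3) by (intro nth_equalityI) auto
  then have "w = v @ drop (length v) w"
    by (metis append_take_drop_id)
  with assms(1) show ?thesis
    by (metis add_cancel_left_right append_Nil2 wlen_eq_0_iff wlen_simps(3))
qed

text \<open>Place each word at the origin of a point of the subshift. All its tiles start before
  time \<open>n\<close>, so \<open>patch_separates\<close> recovers its letters.\<close>

lemma card_pow_le_min_subcover:
  assumes k: "real k \<ge> (1 + Lmax + Lmin / 2) / Lmin" and n: "lam ^ m * L a \<le> real n"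
    and fin: "has_finite_subcover Y (join_cover Y T1 n (patch_cover k))"
  shows "card (subst_pow \<Theta> m a) \<le> min_subcover Y (join_cover Y T1 n (patch_cover k))"
proof -
  obtain xf where xf: "\<And>v. v \<in> subst_pow \<Theta> m a \<Longrightarrow> xf v \<in> X"
      "\<And>v. v \<in> subst_pow \<Theta> m a \<Longrightarrow> map (xf v) [0..int (length v) - 1] = v"
    using word_realized by metis
  have nth: "xf v (int j) = v ! j" if v: "v \<in> subst_pow \<Theta> m a" and j: "j < length v" for v j
    using arg_cong[OF xf(2)[OF v], of "\<lambda>w. w ! j"] j by simp
  have roof: "roof (int j) (xf v) < real n" if v: "v \<in> subst_pow \<Theta> m a" and j: "j < length v" for v j
  proof -
    have "roof (int (length v)) (xf v) = wlen L v"
      using wlen_map_upto[of 0 "int (length v)" "xf v"] xf(2)[OF v] by simp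
    moreover have "roof (int j + 1) (xf v) \<le> roof (int (length v)) (xf v)"
      using j by (intro roof_mono) simp
    ultimately show ?thesis
      using n wlen_subst_pow[OF v] L_pos[of "xf v (int j)"] by (simp add: roof_sum_Suc del: L_pos)
  qed
  show ?thesis
  proof (rule separated_card_le_min_subcover[OF fin, of "\<lambda>v. pt (xf v) 0"])
    show "(\<lambda>v. pt (xf v) 0) ` subst_pow \<Theta> m a \<subseteq> topspace Y"
      using xf(1) pt_in_reps by (auto simp: topspace_Y_top)
    fix B v w assume B: "B \<in> join_cover Y T1 n (patch_cover k)" "pt (xf v) 0 \<in> B" "pt (xf w) 0 \<in> B"
      and v: "v \<in> subst_pow \<Theta> m a" and w: "w \<in> subst_pow \<Theta> m a"
    have same: "v ! j = w ! j" if "j < length v" "j < length w" for j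
      using patch_separates[OF k B xf(1)[OF v] xf(1)[OF w] roof[OF v that(1)]] that nth v w by simp
    have "wlen L v = wlen L w"
      using v w wlen_subst_pow by metis
    \<comment> \<open>The letters agree only up to the shorter length; equal geometric length
      excludes a surplus.\<close>
    then show "v = w"
      using prefix_same_wlen[of v w] prefix_same_wlen[of w v] same
      by (cases "length v \<le> length w") (auto simp: not_le)
  qed
qed

text \<open>The cover entropy is evaluated along times comparable to \<open>lam ^ m * L a\<close>,
  where the join needs at least as many elements as level \<open>m\<close> of \<open>a\<close> has
  words.\<close>

lemma growth_rate_le_cover_entropy:
  assumes h: "(\<lambda>m. g m a) \<longlonglongrightarrow> h"
  shows "\<exists>U. open_cover Y U \<and> h \<le> cover_entropy Y T1 U"
proof -
  obtain k where k: "real k \<ge> (1 + Lmax + Lmin / 2) / Lmin"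
    using real_arch_simple by blast
  let ?U = "patch_cover k"
  let ?N = "\<lambda>n. min_subcover Y (join_cover Y T1 n ?U)"
  have fin: "has_finite_subcover Y (join_cover Y T1 n ?U)" for n
    using join_cover_classes[OF patch_cover_open_cover] by metis
  \<comment> \<open>Rounding up to an integer, and the \<open>Suc\<close> in
    \<open>cover_entropy\<close>, add at most 2, so the ratio to \<open>lam ^ m * L a\<close> still
    tends to 1.\<close>
  define nm where "nm m = nat \<lceil>lam ^ m * L a\<rceil>" for m
  have pos: "lam ^ m * L a > 0" for m
    by simp
  have nm: "lam ^ m * L a \<le> real (nm m)" "real (nm m) \<le> lam ^ m * L a + 1" for m
    using pos[of m] unfolding nm_def by linarith+
  have inv: "(\<lambda>m. 1 / (lam ^ m * L a)) \<longlonglongrightarrow> 0"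
  proof -
    have "(\<lambda>m. (1 / L a) * inverse (lam ^ m)) \<longlonglongrightarrow> (1 / L a) * 0"
      by (intro tendsto_intros LIMSEQ_inverse_realpow_zero lam_gt_1)
    then show ?thesis
      by (simp add: field_simps)
  qed
  have "filterlim (\<lambda>m. lam ^ m * L a) at_top sequentially"
    using filterlim_inverse_at_top[OF inv] pos by simp
  then have "filterlim (\<lambda>m. real (nm m)) at_top sequentially"
    by (rule filterlim_at_top_mono) (use nm in auto)
  then have "filterlim nm at_top sequentially"
    by (simp add: filterlim_sequentially_iff_filterlim_real)
  then have lim: "(\<lambda>m. ln (real (?N (Suc (nm m)))) / real (Suc (nm m))) \<longlonglongrightarrow> cover_entropy Y T1 ?U"
    using filterlim_compose[OF cover_entropy_tendsto[OF T1_in_topspace topspace_Y_nonempty fin]] by blast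
  have ratio: "(\<lambda>m. real (Suc (nm m)) / (lam ^ m * L a)) \<longlonglongrightarrow> 1"
  proof (rule tendsto_sandwich)
    show "\<forall>\<^sub>F m in sequentially. 1 \<le> real (Suc (nm m)) / (lam ^ m * L a)"
      using nm(1) pos by (intro always_eventually allI) (simp add: pos_le_divide_eq add_increasing)
    show "\<forall>\<^sub>F m in sequentially. real (Suc (nm m)) / (lam ^ m * L a) \<le> 1 + 2 * (1 / (lam ^ m * L a))"
    proof (intro always_eventually allI)
      fix m
      have "real (Suc (nm m)) \<le> lam ^ m * L a + 2"
        using nm(2)[of m] by simp
      then have "real (Suc (nm m)) / (lam ^ m * L a) \<le> (lam ^ m * L a + 2) / (lam ^ m * L a)"
        using pos[of m] by (intro divide_right_mono) auto
      then show "real (Suc (nm m)) / (lam ^ m * L a) \<le> 1 + 2 * (1 / (lam ^ m * L a))"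
        by (simp add: add_divide_distrib)
    qed
    have "(\<lambda>m. 1 + 2 * (1 / (lam ^ m * L a))) \<longlonglongrightarrow> 1 + 2 * 0"
      by (intro tendsto_intros inv)
    then show "(\<lambda>m. 1 + 2 * (1 / (lam ^ m * L a))) \<longlonglongrightarrow> 1"
      by simp
  qed simp
  have "g m a \<le> ln (real (?N (Suc (nm m)))) / real (Suc (nm m)) * (real (Suc (nm m)) / (lam ^ m * L a))" for m
  proof -
    have "card (subst_pow \<Theta> m a) \<le> ?N (Suc (nm m))"
      by (rule card_pow_le_min_subcover[OF k _ fin]) (use nm(1)[of m] in simp)
    then have "ln (real (card (subst_pow \<Theta> m a))) \<le> ln (real (?N (Suc (nm m))))"
      by (intro ln_mono) auto
    then have "g m a \<le> ln (real (?N (Suc (nm m)))) / (lam ^ m * L a)"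
      unfolding g_def using pos[of m] by (intro divide_right_mono) auto
    then show ?thesis
      by simp
  qed
  then have "h \<le> cover_entropy Y T1 ?U * 1"
    by (intro LIMSEQ_le[OF h tendsto_mult[OF lim ratio]]) blast
  then show ?thesis
    using patch_cover_open_cover by auto
qed

text \<open>The upper bound holds for every \<open>m\<close>, so letting \<open>m\<close> grow
  removes \<open>\<kappa> / lam ^ m\<close>; the patch cover shows that the supremum over covers
  reaches \<open>h\<close>.\<close>

lemma entropy_eq_growth_rate:
  "\<exists>h. (\<lambda>m. ln (real (card (subst_pow \<Theta> m a))) / (lam ^ m * L a)) \<longlonglongrightarrow> h \<and> ereal h = hull_entropy \<Theta> L"
proof -
  obtain h where h: "\<And>a. (\<lambda>m. g m a) \<longlonglongrightarrow> h" and G: "gmax \<longlonglongrightarrow> h"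
    using growth_rate by blast
  have "cover_entropy Y T1 U \<le> h" if U: "open_cover Y U" for U
  proof -
    have "(\<lambda>m. \<kappa> * inverse (lam ^ m)) \<longlonglongrightarrow> \<kappa> * 0"
      by (intro tendsto_intros LIMSEQ_inverse_realpow_zero lam_gt_1)
    from tendsto_add[OF G this] have "(\<lambda>m. gmax m + \<kappa> / lam ^ m) \<longlonglongrightarrow> h"
      by (simp add: divide_inverse)
    then show ?thesis
      using cover_entropy_le_gmax[OF U topspace_Y_nonempty] by (intro LIMSEQ_le_const) auto
  qed
  then have "hull_entropy \<Theta> L \<le> ereal h"
    unfolding hull_entropy_def top_entropy_def by (intro SUP_least) auto
  moreover obtain U where U: "open_cover Y U" "h \<le> cover_entropy Y T1 U"
    using growth_rate_le_cover_entropy[OF h] by blast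
  have "ereal h \<le> hull_entropy \<Theta> L"
    unfolding hull_entropy_def top_entropy_def by (rule SUP_upper2[of U]) (use U in auto)
  ultimately show ?thesis
    using h[of a] unfolding g_def by (intro exI[of _ h]) auto
qed

end

theorem theoremA:
  fixes \<Theta> :: "('a::finite) rsubst" and lam :: real and L :: "'a \<Rightarrow> real"
  assumes "random_subst \<Theta>"
    and "primitive_rsubst \<Theta>"
    and "geom_compatible_data \<Theta> lam L"
  shows "\<forall>a. \<exists>h. (\<lambda>m. ln (real (card (subst_pow \<Theta> m a))) / (lam ^ m * L a)) \<longlonglongrightarrow> h
              \<and> ereal h = hull_entropy \<Theta> L"
proof -
  interpret geom_rsubst \<Theta> lam L
    by unfold_locales (rule assms)+
  show ?thesis
    using entropy_eq_growth_rate by blast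
qed

end
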